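(* Let $\omega\in\mathbb{R}^d$ be nonresonant, $t_0\in\mathbb{R}$, $y_0\in\mathbb{C}^D$, and let $f(y,\theta)$ be a smooth $\mathbb{C}^D$-valued map of $y\in\mathbb{C}^D$, $\theta\in\mathbb{T}^d$, with Fourier expansion $f(y,\theta)=\sum_{\mathbf{k}\in\mathbb{Z}^d}e^{i\mathbf{k}\cdot\theta}\widehat f_{\mathbf{k}}(y)$. With $\Gamma$ as in the context, set $\kappa(\theta;t_0)=\Gamma(0,\theta;t_0\omega)$, $\bar\alpha(t;t_0)=\Gamma(t-t_0,t_0\omega;t_0\omega)$ and $\bar\beta(t_0)=\left.\frac{d}{dt}\bar\alpha(t;t_0)\right|_{t=t_0}$, and form word series with the maps $f_{\mathbf{k}}(y)=\epsilon\widehat f_{\mathbf{k}}(y)$, $\mathbf{k}\in\mathbb{Z}^d$. Then (in the sense of formal series) the solution $y(t)$ of $$\frac{d}{dt} y= \epsilon f(y,t\omega),\qquad y(t_0) = y_0,$$ may be represented as $$y(t) = W_{\kappa(t\omega;t_0)}(Y(t)),$$ where $Y(t) = W_{\bar\alpha(t;t_0)}(y_0)$ solves the autonomous (averaged) initial value problem $$\frac{d}{dt} Y = W_{\bar\beta(t_0)}(Y),\qquad Y(t_0) = y_0.$$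
   Context: $\mathbb{T}^d=(\mathbb{R}/2\pi\mathbb{Z})^d$. $\mathcal{W}$ is the set of all words (including the empty word $\emptyset$) with letters in the alphabet $\mathbb{Z}^d$, and $\mathbb{C}^{\mathcal{W}}$ is the vector space of all maps $\delta:\mathcal{W}\to\mathbb{C}$, $w\mapsto\delta_w$. Derivatives in $\mathbb{C}^{\mathcal{W}}$ are taken word by word. A vector $\omega\in\mathbb{R}^d$ is nonresonant if $\mathbf{k}\cdot\omega\neq 0$ for every $\mathbf{k}\in\mathbb{Z}^d\setminus\{\mathbf{0}\}$. Word series: given maps $f_\ell:\mathbb{C}^D\to\mathbb{C}^D$, one for each letter $\ell$, the word basis functions are $f_\emptyset(y)=y$, $f_\ell(y)$ for one-letter words, and recursively $f_{\ell_1\cdots\ell_n}(y)=f'_{\ell_2\cdots\ell_n}(y)\,f_{\ell_1}(y)$ for $n>1$, where $f'_{\ell_2\cdots\ell_n}$ is the Jacobian matrix. For $\delta\in\mathbb{C}^{\mathcal{W}}$, the word series is the formal series $W_\delta(y)=\sum_{w\in\mathcal{W}}\delta_w f_w(y)$. All series are formal (no convergence is asserted) and all maps are assumed smooth; since $f_{\mathbf{k}}=\epsilon\widehat f_{\mathbf{k}}$, the basis function of a word with $n$ letters carries the factor $\epsilon^n$. The solution $y(t)$ is understood through its formal expansion $y(t)=W_{\alpha(t;t_0)}(y_0)$, where $\alpha_\emptyset=1$ and $\alpha_{\mathbf{k}_1\cdots \mathbf{k}_n}(t;t_0) = \int_{t_0}^t dt_n\,e^{i\mathbf{k}_n\cdot\omega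 t_n}\int_{t_0}^{t_n}dt_{n-1}\,e^{i\mathbf{k}_{n-1}\cdot\omega t_{n-1}}\cdots \int_{t_0}^{t_2} dt_1\,e^{i\mathbf{k}_1\cdot\omega t_1}$. Definition of $\Gamma(\tau,\theta;\theta_0)\in\mathbb{C}^{\mathcal{W}}$, $\tau\in\mathbb{R}$, $\theta,\theta_0\in\mathbb{T}^d$ (arguments omitted where unambiguous; $\mathbf{0}^r$ is the word of $r$ letters $\mathbf{0}$, and $(\mathbf{k}+\mathbf{l}_1)$ is a single letter): $\Gamma_\emptyset=1$ and, for $r\ge1$, $\mathbf{k}\in\mathbb{Z}^d\setminus\{\mathbf{0}\}$, $s\ge1$, $\mathbf{l}_1,\dots,\mathbf{l}_s\in\mathbb{Z}^d$: $\Gamma_{\mathbf{k}}=\frac{i}{\mathbf{k}\cdot\omega}(e^{i\mathbf{k}\cdot\theta_0}-e^{i\mathbf{k}\cdot\theta})$; $\Gamma_{\mathbf{0}^r}=\tau^r/r!$; $\Gamma_{\mathbf{0}^r\mathbf{k}}=\frac{i}{\mathbf{k}\cdot\omega}(\Gamma_{\mathbf{0}^{r-1}\mathbf{k}}-\Gamma_{\mathbf{0}^r}e^{i\mathbf{k}\cdot\theta})$; $\Gamma_{\mathbf{k}\mathbf{l}_1\cdots\mathbf{l}_s}=\frac{i}{\mathbf{k}\cdot\omega}(e^{i\mathbf{k}\cdot\theta_0}\Gamma_{\mathbf{l}_1\cdots\mathbf{l}_s}-\Gamma_{(\mathbf{k}+\mathbf{l}_1)\mathbf{l}_2\cdots\mathbf{l}_s})$;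 $\Gamma_{\mathbf{0}^r\mathbf{k}\mathbf{l}_1\cdots\mathbf{l}_s}=\frac{i}{\mathbf{k}\cdot\omega}(\Gamma_{\mathbf{0}^{r-1}\mathbf{k}\mathbf{l}_1\cdots\mathbf{l}_s}-\Gamma_{\mathbf{0}^r(\mathbf{k}+\mathbf{l}_1)\mathbf{l}_2\cdots\mathbf{l}_s})$. *)

theory Defs
  imports "HOL-Analysis.Analysis" "HOL-Library.Multiset"
begin

section \<open>Letters, words, smooth maps, Fourier coefficients\<close>

type_synonym 'd letter = "int ^ 'd"
type_synonym 'd word = "'d letter list"

definition kdot :: "'d::finite letter \<Rightarrow> real ^ 'd \<Rightarrow> real" where
  "kdot k \<theta> = (\<Sum>j\<in>UNIV. real_of_int (k $ j) * \<theta> $ j)"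

definition nonresonant :: "real ^ 'd::finite \<Rightarrow> bool" where
  "nonresonant \<omega> \<longleftrightarrow> (\<forall>k. k \<noteq> 0 \<longrightarrow> kdot k \<omega> \<noteq> 0)"

primrec differentiable_upto ::
    "nat \<Rightarrow> ('a::real_normed_vector \<Rightarrow> 'b::real_normed_vector) \<Rightarrow> bool" where
  "differentiable_upto 0 g \<longleftrightarrow> continuous_on UNIV g"
| "differentiable_upto (Suc n) g \<longleftrightarrow>
     (\<forall>x. g differentiable (at x)) \<and>
     (\<forall>v. differentiable_upto n (\<lambda>x. frechet_derivative g (at x) v))"

definition smooth :: "('a::real_normed_vector \<Rightarrow> 'b::real_normed_vector) \<Rightarrow> bool" where
  "smooth g \<longleftrightarrow> (\<forall>n. differentiable_upto n g)"

text \<open>Functions on the torus are \<open>2\<pi>\<close>-periodic functions of \<open>\<theta> \<in> \<real>\<^sup>d\<close>.\<close>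

definition torus_periodic :: "(real ^ 'd::finite \<Rightarrow> 'b) \<Rightarrow> bool" where
  "torus_periodic g \<longleftrightarrow> (\<forall>\<theta> j. g (\<theta> + axis j (2 * pi)) = g \<theta>)"

text \<open>A map of \<open>\<complex>\<^sup>D\<close> into itself has a (complex) Jacobian matrix at every point. The Frechet
  derivative of the library is a priori only real linear; under this condition it is
  multiplication by the Jacobian matrix.\<close>

definition has_jacobian_matrices :: "(complex ^ 'n::finite \<Rightarrow> complex ^ 'n) \<Rightarrow> bool" where
  "has_jacobian_matrices g \<longleftrightarrow>
     (\<forall>y. \<exists>A :: complex ^ 'n ^ 'n. (g has_derivative (\<lambda>v. A *v v)) (at y))"

definition fourier_coeff ::
    "(complex ^ 'n::finite \<Rightarrow> real ^ 'd::finite \<Rightarrow> complex ^ 'n) \<Rightarrow> 'd letter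
      \<Rightarrow> complex ^ 'n \<Rightarrow> complex ^ 'n" where
  "fourier_coeff f k y =
     (1 / (2 * pi) ^ CARD('d)) *\<^sub>R
       integral (cbox 0 (\<chi> j. 2 * pi)) (\<lambda>\<theta>. cis (- kdot k \<theta>) *s f y \<theta>)"


section \<open>Word series\<close>

fun word_basis ::
    "('l \<Rightarrow> complex ^ 'n::finite \<Rightarrow> complex ^ 'n) \<Rightarrow> 'l list \<Rightarrow> complex ^ 'n \<Rightarrow> complex ^ 'n" where
  "word_basis F [] = (\<lambda>y. y)"
| "word_basis F [l] = F l"
| "word_basis F (l # l' # w) = (\<lambda>y. frechet_derivative (word_basis F (l' # w)) (at y) (F l y))"

text \<open>
  Formal series. With infinitely many letters there are infinitely many words of each length, and
  the corresponding sums need not converge. A formal series is therefore graded by the multiset of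
  the letters that enter each of its terms: \<open>S M\<close> is the sum of all terms in which the maps
  \<open>F l\<close> occur with multiplicities \<open>count M l\<close>. Each such sum is finite, two formal series are
  equal iff they agree in every grade, and differentiation with respect to a parameter is done
  grade by grade. If every \<open>F l\<close> carries a factor \<open>\<epsilon>\<close>, the grade \<open>M\<close> carries \<open>\<epsilon> ^ size M\<close>,
  so that the terms of order \<open>\<epsilon> ^ n\<close> are those of the grades of size \<open>n\<close>.
\<close>

type_synonym ('l, 'n) formal_series = "'l multiset \<Rightarrow> complex ^ 'n"

definition const_series :: "complex ^ 'n::finite \<Rightarrow> ('l, 'n) formal_series" where
  "const_series y = (\<lambda>M. if M = {#} then y else 0)"

text \<open>The word series \<open>W\<^sub>\<delta>(y)\<close> at a point \<open>y\<close>.\<close>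

definition word_series ::
    "('l \<Rightarrow> complex ^ 'n::finite \<Rightarrow> complex ^ 'n) \<Rightarrow> ('l list \<Rightarrow> complex) \<Rightarrow> complex ^ 'n
      \<Rightarrow> ('l, 'n) formal_series" where
  "word_series F \<delta> y = (\<lambda>M. \<Sum>w\<in>{w. mset w = M}. \<delta> w *s word_basis F w y)"

text \<open>\<open>iterated_deriv g [v\<^sub>1, \<dots>, v\<^sub>m] y\<close> is the \<open>m\<close>-th derivative of \<open>g\<close> at \<open>y\<close>, a symmetric
  multilinear map if \<open>g\<close> is smooth, evaluated at \<open>v\<^sub>1, \<dots>, v\<^sub>m\<close>.\<close>

primrec iterated_deriv ::
    "('a::real_normed_vector \<Rightarrow> 'b::real_normed_vector) \<Rightarrow> 'a list \<Rightarrow> 'a \<Rightarrow> 'b" where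
  "iterated_deriv g [] = g"
| "iterated_deriv g (v # vs) = (\<lambda>y. frechet_derivative (iterated_deriv g vs) (at y) v)"

text \<open>
  Substitution of a formal series \<open>Y\<close> into a map \<open>g\<close>: the Taylor expansion of \<open>g\<close> at the constant
  term \<open>y = Y {#}\<close>,
  \<open>g(y + \<Sum>\<^bsub>A\<noteq>{#}\<^esub> Y A) = \<Sum>\<^sub>m 1/m! \<Sum>\<^bsub>A\<^sub>1,\<dots>,A\<^sub>m\<noteq>{#}\<^esub> g\<^bsup>(m)\<^esup>(y)[Y A\<^sub>1, \<dots>, Y A\<^sub>m]\<close>,
  with the terms collected according to \<open>A\<^sub>1 + \<dots> + A\<^sub>m\<close>.
\<close>

definition formal_subst ::
    "(complex ^ 'n::finite \<Rightarrow> complex ^ 'n) \<Rightarrow> ('l, 'n) formal_series \<Rightarrow> ('l, 'n) formal_series" where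
  "formal_subst g Y = (\<lambda>M. \<Sum>As\<in>{As. {#} \<notin> set As \<and> sum_list As = M}.
     (1 / fact (length As)) *\<^sub>R iterated_deriv g (map Y As) (Y {#}))"

text \<open>The word series \<open>W\<^sub>\<delta>(Y)\<close> at a formal series \<open>Y\<close>: the basis function of \<open>w\<close> contributes the
  letters of \<open>w\<close> to the grade.\<close>

definition word_series_subst ::
    "('l \<Rightarrow> complex ^ 'n::finite \<Rightarrow> complex ^ 'n) \<Rightarrow> ('l list \<Rightarrow> complex) \<Rightarrow> ('l, 'n) formal_series
      \<Rightarrow> ('l, 'n) formal_series" where
  "word_series_subst F \<delta> Y = (\<lambda>M. \<Sum>w\<in>{w. mset w \<subseteq># M}.
     \<delta> w *s formal_subst (word_basis F w) Y (M - mset w))"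

text \<open>The formal series \<open>\<Sum>\<^sub>k e\<^bsup>i k\<cdot>\<theta>\<^esup> F\<^sub>k(Y)\<close>; for \<open>F\<^sub>k = \<epsilon> fourier_coeff f k\<close> this is \<open>\<epsilon> f(Y, \<theta>)\<close>.\<close>

definition fourier_series_subst ::
    "('d::finite letter \<Rightarrow> complex ^ 'n::finite \<Rightarrow> complex ^ 'n) \<Rightarrow> ('d letter, 'n) formal_series
      \<Rightarrow> real ^ 'd \<Rightarrow> ('d letter, 'n) formal_series" where
  "fourier_series_subst F Y \<theta> = (\<lambda>M. \<Sum>k\<in>set_mset M.
     cis (kdot k \<theta>) *s formal_subst (F k) Y (M - {#k#}))"

definition solves_formal_ivp ::
    "(real \<Rightarrow> ('l, 'n::finite) formal_series \<Rightarrow> ('l, 'n) formal_series) \<Rightarrow> real \<Rightarrow> complex ^ 'n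
      \<Rightarrow> (real \<Rightarrow> ('l, 'n) formal_series) \<Rightarrow> bool" where
  "solves_formal_ivp rhs t0 y0 Y \<longleftrightarrow>
     Y t0 = const_series y0 \<and>
     (\<forall>t M. ((\<lambda>s. Y s M) has_vector_derivative rhs t (Y t) M) (at t))"

lemma finite_words_below: "finite {w. mset w \<subseteq># M}"
proof (rule finite_subset)
  show "{w. mset w \<subseteq># M} \<subseteq> {w. set w \<subseteq> set_mset M \<and> length w \<le> size M}"
    using set_mset_mono size_mset_mono by fastforce
  show "finite {w. set w \<subseteq> set_mset M \<and> length w \<le> size M}"
    by (simp add: finite_lists_length_le)
qed

lemma finite_words_of_grade: "finite {w. mset w = M}"
  by (rule finite_subset[OF _ finite_words_below[of M]]) auto

lemma finite_grade_decompositions: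
  "finite {As. {#} \<notin> set As \<and> sum_list As = (M :: 'l multiset)}"
proof (rule finite_subset)
  have le: "A \<subseteq># sum_list As" if "A \<in> set As" for A and As :: "'l multiset list"
    using that by (induction As) (auto intro: subset_mset.add_increasing subset_mset.add_increasing2)
  have len: "length As \<le> size (sum_list As)" if "{#} \<notin> set As" for As :: "'l multiset list"
    using that
  proof (induction As)
    case (Cons A As)
    then have "size A > 0" by (auto simp: nonempty_has_size)
    with Cons show ?case by auto
  qed simp
  show "{As. {#} \<notin> set As \<and> sum_list As = M}
      \<subseteq> {As. set As \<subseteq> {A. A \<subseteq># M} \<and> length As \<le> size M}"
    using le len by auto
  have "{A. A \<subseteq># M} \<subseteq> mset ` {w. mset w \<subseteq># M}"
    by (auto simp: image_iff) (metis ex_mset)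
  then have "finite {A. A \<subseteq># M}"
    by (rule finite_subset) (simp add: finite_words_below)
  then show "finite {As. set As \<subseteq> {A. A \<subseteq># M} \<and> length As \<le> size M}"
    by (rule finite_lists_length_le)
qed


section \<open>The coefficients\<close>

text \<open>The iterated integrals \<open>\<alpha>(t;t\<^sub>0)\<close>; the outermost integral belongs to the last letter of the
  word, so the recursion is on the reversed word.\<close>

primrec iterated_integral :: "real ^ 'd::finite \<Rightarrow> real \<Rightarrow> 'd word \<Rightarrow> real \<Rightarrow> complex" where
  "iterated_integral \<omega> t0 [] t = 1"
| "iterated_integral \<omega> t0 (k # ks) t =
     (LBINT s=t0..t. cis (kdot k \<omega> * s) * iterated_integral \<omega> t0 ks s)"

definition alpha :: "real ^ 'd::finite \<Rightarrow> real \<Rightarrow> real \<Rightarrow> 'd word \<Rightarrow> complex" where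
  "alpha \<omega> t0 t w = iterated_integral \<omega> t0 (rev w) t"

text \<open>\<open>Gamma_coeff0 \<omega> \<tau> \<theta> \<theta>\<^sub>0 r w\<close> is the coefficient of the word \<open>0\<^sup>r w\<close>.\<close>

function Gamma_coeff0 ::
    "real ^ 'd::finite \<Rightarrow> real \<Rightarrow> real ^ 'd \<Rightarrow> real ^ 'd \<Rightarrow> nat \<Rightarrow> 'd word \<Rightarrow> complex" where
  "Gamma_coeff0 \<omega> \<tau> \<theta> \<theta>0 r [] = of_real (\<tau> ^ r / fact r)"
| "Gamma_coeff0 \<omega> \<tau> \<theta> \<theta>0 r (k # w) =
     (if k = 0 then Gamma_coeff0 \<omega> \<tau> \<theta> \<theta>0 (Suc r) w
      else \<i> / of_real (kdot k \<omega>) *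
        ((case r of
            0 \<Rightarrow> cis (kdot k \<theta>0) * Gamma_coeff0 \<omega> \<tau> \<theta> \<theta>0 0 w
          | Suc q \<Rightarrow> Gamma_coeff0 \<omega> \<tau> \<theta> \<theta>0 q (k # w))
         - (case w of
            [] \<Rightarrow> Gamma_coeff0 \<omega> \<tau> \<theta> \<theta>0 r [] * cis (kdot k \<theta>)
          | l # ls \<Rightarrow> Gamma_coeff0 \<omega> \<tau> \<theta> \<theta>0 r ((k + l) # ls))))"
  by pat_completeness auto
termination
  by (relation "Wellfounded.measure (\<lambda>(\<omega>, \<tau>, \<theta>, \<theta>0, r, w). r + 2 * length w)") auto

definition Gamma_coeff ::
    "real ^ 'd::finite \<Rightarrow> real \<Rightarrow> real ^ 'd \<Rightarrow> real ^ 'd \<Rightarrow> 'd word \<Rightarrow> complex" where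
  "Gamma_coeff \<omega> \<tau> \<theta> \<theta>0 w = Gamma_coeff0 \<omega> \<tau> \<theta> \<theta>0 0 w"

lemma Gamma_coeff_replicate_append:
  "Gamma_coeff \<omega> \<tau> \<theta> \<theta>0 (replicate r 0 @ w) = Gamma_coeff0 \<omega> \<tau> \<theta> \<theta>0 r w"
proof -
  have "Gamma_coeff0 \<omega> \<tau> \<theta> \<theta>0 q (replicate r 0 @ w) = Gamma_coeff0 \<omega> \<tau> \<theta> \<theta>0 (q + r) w" for q
    by (induction r arbitrary: q) auto
  then show ?thesis by (simp add: Gamma_coeff_def)
qed

text \<open>The defining recursion in terms of words.\<close>

lemma Gamma_coeff_recursion:
  fixes \<omega> \<theta> \<theta>0 :: "real ^ 'd::finite" and \<tau> :: real
  defines "G \<equiv> Gamma_coeff \<omega> \<tau> \<theta> \<theta>0"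
  assumes "k \<noteq> 0"
  shows "G [] = 1"
    and "G [k] = \<i> / of_real (kdot k \<omega>) * (cis (kdot k \<theta>0) - cis (kdot k \<theta>))"
    and "G (replicate r 0) = of_real (\<tau> ^ r / fact r)"
    and "G (replicate (Suc q) 0 @ [k]) = \<i> / of_real (kdot k \<omega>) *
           (G (replicate q 0 @ [k]) - G (replicate (Suc q) 0) * cis (kdot k \<theta>))"
    and "G (k # l # ls) = \<i> / of_real (kdot k \<omega>) *
           (cis (kdot k \<theta>0) * G (l # ls) - G ((k + l) # ls))"
    and "G (replicate (Suc q) 0 @ k # l # ls) = \<i> / of_real (kdot k \<omega>) *
           (G (replicate q 0 @ k # l # ls) - G (replicate (Suc q) 0 @ (k + l) # ls))"
proof -
  note * = Gamma_coeff_replicate_append[of \<omega> \<tau> \<theta> \<theta>0, folded G_def]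
  have **: "G w = Gamma_coeff0 \<omega> \<tau> \<theta> \<theta>0 0 w" for w by (simp add: G_def Gamma_coeff_def)
  have z: "G (replicate r 0) = of_real (\<tau> ^ r / fact r)" for r
    using *[of r "[]"] by simp
  show "G [] = 1" by (simp add: **)
  show "G [k] = \<i> / of_real (kdot k \<omega>) * (cis (kdot k \<theta>0) - cis (kdot k \<theta>))"
    using \<open>k \<noteq> 0\<close> by (simp add: **)
  show "G (replicate r 0) = of_real (\<tau> ^ r / fact r)" by (rule z)
  show "G (replicate (Suc q) 0 @ [k]) = \<i> / of_real (kdot k \<omega>) *
          (G (replicate q 0 @ [k]) - G (replicate (Suc q) 0) * cis (kdot k \<theta>))"
    unfolding * z using \<open>k \<noteq> 0\<close> by (subst Gamma_coeff0.simps(2)) simp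
  show "G (k # l # ls) = \<i> / of_real (kdot k \<omega>) *
          (cis (kdot k \<theta>0) * G (l # ls) - G ((k + l) # ls))"
    unfolding ** using \<open>k \<noteq> 0\<close> by (subst Gamma_coeff0.simps(2)) simp
  show "G (replicate (Suc q) 0 @ k # l # ls) = \<i> / of_real (kdot k \<omega>) *
          (G (replicate q 0 @ k # l # ls) - G (replicate (Suc q) 0 @ (k + l) # ls))"
    unfolding * using \<open>k \<noteq> 0\<close> by (subst Gamma_coeff0.simps(2)) simp
qed

definition kappa :: "real ^ 'd::finite \<Rightarrow> real \<Rightarrow> real ^ 'd \<Rightarrow> 'd word \<Rightarrow> complex" where
  "kappa \<omega> t0 \<theta> = Gamma_coeff \<omega> 0 \<theta> (t0 *\<^sub>R \<omega>)"

definition alpha_bar :: "real ^ 'd::finite \<Rightarrow> real \<Rightarrow> real \<Rightarrow> 'd word \<Rightarrow> complex" where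
  "alpha_bar \<omega> t0 t = Gamma_coeff \<omega> (t - t0) (t0 *\<^sub>R \<omega>) (t0 *\<^sub>R \<omega>)"

definition beta_bar :: "real ^ 'd::finite \<Rightarrow> real \<Rightarrow> 'd word \<Rightarrow> complex" where
  "beta_bar \<omega> t0 w = vector_derivative (\<lambda>t. alpha_bar \<omega> t0 t w) (at t0)"

end

theory Submission
  imports Defs "HOL-Computational_Algebra.Polynomial"
begin

text \<open>
  A letter \<open>l\<close> acts on maps as the derivation \<open>g \<mapsto> g' F\<^sub>l\<close>, and a word \<open>w\<close> as the composition \<open>D\<^sub>w\<close> of
  the derivations of its letters. Then \<open>f\<^sub>w = D\<^sub>w id\<close> and \<open>D\<^sub>v f\<^sub>w = f\<^bsub>v w\<^esub>\<close>. Suppose that substituting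
  \<open>W\<^sub>\<delta>(y)\<close> into any map \<open>g\<close> gives \<open>\<Sum>\<^sub>v \<delta>\<^sub>v D\<^sub>v g(y)\<close> (\<open>formal_subst_word_series\<close>). Then word series
  compose by the convolution of their coefficients along cuts of words,
  \<open>W\<^sub>\<eta>(W\<^sub>\<delta>(y)) = W\<^bsub>\<delta> \<star> \<eta>\<^esub>(y)\<close> with \<open>(\<delta> \<star> \<eta>)\<^sub>u = \<Sum>\<^bsub>u = v w\<^esub> \<delta>\<^sub>v \<eta>\<^sub>w\<close> (\<open>word_series_subst_word_series\<close>),
  and the claims become identities between coefficients:

  \<^item> \<open>\<alpha>(t; t\<^sub>0) = \<Gamma>(t - t\<^sub>0, t \<omega>; t\<^sub>0 \<omega>)\<close> (\<open>alpha_eq_Gamma_coeff\<close>), because both sides satisfy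
    \<open>\<delta>'\<^bsub>v k\<^esub> = e\<^bsup>i k\<cdot>\<omega> t\<^esup> \<delta>\<^sub>v\<close> with the same initial values; these equations are the oscillatory
    system for \<open>W\<^sub>\<delta>(y\<^sub>0)\<close>;

  \<^item> the cocycle identity \<open>\<Gamma>(\<tau>\<^sub>1, \<theta>\<^sub>1; \<theta>\<^sub>0) \<star> \<Gamma>(\<tau>\<^sub>2, \<theta>\<^sub>2; \<theta>\<^sub>1) = \<Gamma>(\<tau>\<^sub>1 + \<tau>\<^sub>2, \<theta>\<^sub>2; \<theta>\<^sub>0)\<close>
    (\<open>Gamma_coeff_cocycle\<close>). For \<open>\<tau>\<^sub>2 = 0\<close> it factors \<open>\<alpha>\<close> into the averaged solution followed by the
    change of variables \<open>\<kappa>\<close>; for \<open>\<theta>\<^sub>0 = \<theta>\<^sub>1 = \<theta>\<^sub>2\<close> it makes the averaged coefficients a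
    one-parameter group, whose generator is the coefficient family of the averaged equation.

  The substitution formula for \<open>\<delta> = \<Gamma>\<close> holds because \<open>D\<^sub>v g\<close> is the sum, over all partitions of
  the positions of \<open>v\<close> into blocks, of a derivative of \<open>g\<close> in the directions \<open>f\<^sub>w\<close>, \<open>w\<close> running
  through the blocks, and because the sum of \<open>\<Gamma>\<^sub>v D\<^sub>v g\<close> over words and partitions equals the Taylor sum
  of products of coefficients \<open>\<Gamma>\<^sub>w\<close> over lists of blocks (\<open>Gamma_coeff_character\<close>). Along the line
  \<open>\<tau> \<mapsto> (\<tau>, \<theta>; \<theta> - \<tau> \<omega>)\<close> the latter identity follows by comparing differential equations grade
  by grade. The coefficients of the averaged solution do not lie on such a line; but for fixed \<open>\<theta>\<close>
  both sides are polynomial in \<open>\<tau>\<close> and trigonometric in \<open>\<theta>\<^sub>0\<close>, and for nonresonant \<open>\<omega>\<close> such a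
  function vanishes everywhere once it vanishes on one line (\<open>quasi_polynomial_zero_on_line\<close>).
\<close>


section \<open>The recursion for the coefficients and the cocycle identity\<close>

lemma kdot_add: "kdot (k + l) \<theta> = kdot k \<theta> + kdot l \<theta>"
  by (simp add: kdot_def algebra_simps sum.distrib)

lemma kdot_line: "kdot k (\<theta> + t *\<^sub>R \<omega>) = kdot k \<theta> + t * kdot k \<omega>"
  by (simp add: kdot_def algebra_simps sum.distrib sum_distrib_left)

lemma kdot_zero_left [simp]: "kdot 0 \<theta> = 0"
  by (simp add: kdot_def)

lemma kdot_minus: "kdot k (- \<theta>) = - kdot k \<theta>"
  by (simp add: kdot_def sum_negf)

lemma kdot_scale: "kdot k (t *\<^sub>R \<omega>) = t * kdot k \<omega>"
  by (simp add: kdot_def sum_distrib_left mult.left_commute)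

lemma Gamma_coeff0_single:
  assumes "k \<noteq> 0"
  shows "Gamma_coeff0 \<omega> \<tau> \<theta> \<theta>0 r [k] = \<i> / of_real (kdot k \<omega>) *
    ((if r = 0 then cis (kdot k \<theta>0) else Gamma_coeff0 \<omega> \<tau> \<theta> \<theta>0 (r - 1) [k])
      - Gamma_coeff0 \<omega> \<tau> \<theta> \<theta>0 r [] * cis (kdot k \<theta>))"
  using assms by (cases r) simp_all

lemma Gamma_coeff0_merge:
  assumes "k \<noteq> 0"
  shows "Gamma_coeff0 \<omega> \<tau> \<theta> \<theta>0 r (k # l # w) = \<i> / of_real (kdot k \<omega>) *
    ((if r = 0 then cis (kdot k \<theta>0) * Gamma_coeff0 \<omega> \<tau> \<theta> \<theta>0 0 (l # w)
      else Gamma_coeff0 \<omega> \<tau> \<theta> \<theta>0 (r - 1) (k # l # w))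
      - Gamma_coeff0 \<omega> \<tau> \<theta> \<theta>0 r ((k + l) # w))"
  using assms by (subst Gamma_coeff0.simps(2), cases r) simp_all

text \<open>
  The recursion removes letters by merging them, so it is not structural in the word. Here
  \<open>r\<close> counts leading zero letters that have already been split off.
\<close>

lemma Gamma_coeff0_induct [case_names Nil Zero Single Merge]:
  fixes P :: "nat \<Rightarrow> 'd::finite word \<Rightarrow> bool"
  assumes "\<And>r. P r []"
    and "\<And>r w. P (Suc r) w \<Longrightarrow> P r (0 # w)"
    and "\<And>r k. k \<noteq> 0 \<Longrightarrow> P r [] \<Longrightarrow> (r > 0 \<Longrightarrow> P (r - 1) [k]) \<Longrightarrow> P r [k]"
    and "\<And>r k l w. k \<noteq> 0 \<Longrightarrow> (r = 0 \<Longrightarrow> P 0 (l # w)) \<Longrightarrow> (r > 0 \<Longrightarrow> P (r - 1) (k # l # w)) \<Longrightarrow>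
         P r ((k + l) # w) \<Longrightarrow> P r (k # l # w)"
  shows "P r w"
proof (induction "r + 2 * length w" arbitrary: r w rule: less_induct)
  case less
  show ?case
  proof (cases w rule: remdups_adj.cases)
    case 1
    then show ?thesis using assms(1) by simp
  next
    case (2 k)
    then show ?thesis using assms(2)[of r "[]"] assms(3)[of k r] less by (cases "k = 0") auto
  next
    case (3 k l v)
    then show ?thesis using assms(2)[of r "l # v"] assms(4)[of k r l v] less by (cases "k = 0") auto
  qed
qed

lemma Gamma_coeff0_initial:
  "Gamma_coeff0 \<omega> 0 \<theta> \<theta> r w = (if r = 0 \<and> w = [] then 1 else 0)"
proof (induction r w rule: Gamma_coeff0_induct)
  case (Single r k)
  then show ?case by (subst Gamma_coeff0_single) auto
next
  case (Merge r k l w)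
  then show ?case by (subst Gamma_coeff0_merge) auto
qed auto

text \<open>
  The convolution product dual to the deconcatenation of words.
\<close>

definition deconcat :: "('l list \<Rightarrow> complex) \<Rightarrow> ('l list \<Rightarrow> complex) \<Rightarrow> 'l list \<Rightarrow> complex" where
  "deconcat a b w = (\<Sum>i\<le>length w. a (take i w) * b (drop i w))"

lemma deconcat_Nil [simp]: "deconcat a b [] = a [] * b []"
  by (simp add: deconcat_def)

lemma deconcat_Cons [simp]: "deconcat a b (x # w) = a [] * b (x # w) + deconcat (\<lambda>v. a (x # v)) b w"
  by (simp add: deconcat_def sum.atMost_Suc_shift del: sum.atMost_Suc)

lemma deconcat_scale_diff:
  "deconcat (\<lambda>v. c * (a v - a' v)) b w = c * (deconcat a b w - deconcat a' b w)"
  by (simp add: deconcat_def sum_subtractf sum_distrib_left algebra_simps)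

lemma deconcat_scale: "deconcat (\<lambda>v. c * a v) b w = c * deconcat a b w"
  by (simp add: deconcat_def sum_distrib_left algebra_simps)

text \<open>
  The left-hand side is the convolution at the word \<open>0\<^sup>r w\<close>: the sum runs over the cuts inside
  \<open>0\<^sup>r\<close>, the remaining cuts fall inside \<open>w\<close>. It satisfies the recursion of the right-hand side,
  because the terms with the intermediate phase \<open>e\<^bsup>i k\<cdot>\<theta>\<^sub>1\<^esup>\<close>, produced by the cuts immediately before
  and immediately after the letter \<open>k\<close>, cancel.
\<close>

lemma Gamma_coeff0_cocycle:
  fixes \<omega> \<theta>0 \<theta>1 \<theta>2 :: "real ^ 'd::finite" and \<tau>1 \<tau>2 :: real
  defines "A \<equiv> Gamma_coeff0 \<omega> \<tau>1 \<theta>1 \<theta>0" and "B \<equiv> Gamma_coeff0 \<omega> \<tau>2 \<theta>2 \<theta>1"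
    and "C \<equiv> Gamma_coeff0 \<omega> (\<tau>1 + \<tau>2) \<theta>2 \<theta>0"
  shows "(\<Sum>j<r. A j [] * B (r - j) w) + deconcat (A r) (B 0) w = C r w"
proof -
  have A0: "A 0 [] = 1" and B0: "B 0 [] = 1" by (simp_all add: A_def B_def)
  show ?thesis
  proof (induction r w rule: Gamma_coeff0_induct)
    case (Nil r)
    have "(\<Sum>j<r. A j [] * B (r - j) []) + A r [] * B 0 [] = (\<Sum>j\<le>r. A j [] * B (r - j) [])"
      by (simp add: lessThan_Suc_atMost[symmetric])
    also have "\<dots> = of_real (\<Sum>j\<le>r. (\<tau>1 ^ j / fact j) * (\<tau>2 ^ (r - j) / fact (r - j)))"
      by (simp add: A_def B_def)
    also have "(\<Sum>j\<le>r. (\<tau>1 ^ j / fact j) * (\<tau>2 ^ (r - j) / fact (r - j))) = (\<tau>1 + \<tau>2) ^ r / fact r"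
      unfolding binomial_ring sum_divide_distrib
      by (intro sum.cong) (auto simp: binomial_fact field_simps)
    finally show ?case by (simp add: C_def)
  next
    case (Zero r w)
    have "(\<Sum>j<r. A j [] * B (r - j) (0 # w)) = (\<Sum>j<r. A j [] * B (Suc r - j) w)"
      by (auto intro!: sum.cong simp: B_def Suc_diff_le)
    moreover have "deconcat (A r) (B 0) (0 # w) = A r [] * B 1 w + deconcat (A (Suc r)) (B 0) w"
      by (simp add: A_def B_def)
    moreover have "C r (0 # w) = C (Suc r) w" by (simp add: C_def)
    ultimately show ?case using Zero by (simp add: add.assoc)
  next
    case (Single r k)
    define c where "c = \<i> / complex_of_real (kdot k \<omega>)"
    note single = Gamma_coeff0_single[OF Single(1), of \<omega>, folded c_def]
    note A = single[of \<tau>1 \<theta>1 \<theta>0, folded A_def] and B = single[of \<tau>2 \<theta>2 \<theta>1, folded B_def]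
      and C = single[of "\<tau>1 + \<tau>2" \<theta>2 \<theta>0, folded C_def]
    show ?case
    proof (cases r)
      case 0
      have "C 0 [] = 1" by (simp add: C_def)
      with 0 show ?thesis by (simp add: A[of 0] B[of 0] C[of 0] A0 B0) (simp add: algebra_simps)
    next
      case (Suc q)
      let ?e = "cis (kdot k \<theta>2)"
      have sum: "(\<Sum>j<Suc q. A j [] * B (Suc q - j) [k]) = c * ((\<Sum>j<Suc q. A j [] * B (q - j) [k]) -
          (\<Sum>j<Suc q. A j [] * B (Suc q - j) []) * ?e)"
      proof -
        have "(\<Sum>j<Suc q. A j [] * B (Suc q - j) [k]) =
            (\<Sum>j<Suc q. A j [] * (c * (B (q - j) [k] - B (Suc q - j) [] * ?e)))"
          by (intro sum.cong refl, subst B) (auto simp: Suc_diff_le)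
        then show ?thesis
          by (simp add: sum_subtractf sum_distrib_left sum_distrib_right algebra_simps)
      qed
      have "C (Suc q) [k] = c * (C q [k] - C (Suc q) [] * ?e)" by (simp add: C[of "Suc q"])
      also have "\<dots> = c * ((\<Sum>j<q. A j [] * B (q - j) [k]) + (A q [] * B 0 [k] + A q [k] * B 0 []) -
          ((\<Sum>j<Suc q. A j [] * B (Suc q - j) []) + A (Suc q) [] * B 0 []) * ?e)"
        using Single(2,3) Suc by simp
      also have "\<dots> = (\<Sum>j<Suc q. A j [] * B (Suc q - j) [k]) + (A (Suc q) [] * B 0 [k] + A (Suc q) [k] * B 0 [])"
        unfolding sum by (simp add: A[of "Suc q"] B[of 0] B0 algebra_simps)
      finally show ?thesis using Suc by simp
    qed
  next
    case (Merge r k l w)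
    define c where "c = \<i> / complex_of_real (kdot k \<omega>)"
    note single = Gamma_coeff0_single[OF Merge(1), of \<omega> \<tau>1 \<theta>1 \<theta>0, folded c_def A_def]
    note merge = Gamma_coeff0_merge[OF Merge(1), of \<omega>, folded c_def]
    note A = merge[of \<tau>1 \<theta>1 \<theta>0, folded A_def] and B = merge[of \<tau>2 \<theta>2 \<theta>1, folded B_def]
      and C = merge[of "\<tau>1 + \<tau>2" \<theta>2 \<theta>0, folded C_def]
    show ?case
    proof (cases r)
      case 0
      let ?e = "cis (kdot k \<theta>0)"
      have tail: "deconcat (\<lambda>v. A 0 (k # l # v)) (B 0) w =
          c * (?e * deconcat (\<lambda>v. A 0 (l # v)) (B 0) w - deconcat (\<lambda>v. A 0 ((k + l) # v)) (B 0) w)"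
        unfolding A[of 0] by (simp add: deconcat_scale_diff deconcat_scale)
      have "deconcat (\<lambda>v. A 0 (l # v)) (B 0) w = C 0 (l # w) - A 0 [] * B 0 (l # w)"
        and "deconcat (\<lambda>v. A 0 ((k + l) # v)) (B 0) w = C 0 ((k + l) # w) - A 0 [] * B 0 ((k + l) # w)"
        using Merge(2,4) 0 by (auto simp: eq_diff_eq add.commute)
      with 0 show ?thesis
        by (simp add: tail single[of 0] B[of 0] C[of 0 l w] A0) (simp add: algebra_simps)
    next
      case (Suc q)
      have sum: "(\<Sum>j<Suc q. A j [] * B (Suc q - j) (k # l # w)) = c * ((\<Sum>j<Suc q. A j [] * B (q - j) (k # l # w)) -
          (\<Sum>j<Suc q. A j [] * B (Suc q - j) ((k + l) # w)))"
      proof -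
        have "(\<Sum>j<Suc q. A j [] * B (Suc q - j) (k # l # w)) =
            (\<Sum>j<Suc q. A j [] * (c * (B (q - j) (k # l # w) - B (Suc q - j) ((k + l) # w))))"
          by (intro sum.cong refl, subst B) (auto simp: Suc_diff_le)
        then show ?thesis
          by (simp add: sum_subtractf sum_distrib_left sum_distrib_right algebra_simps)
      qed
      have tail: "deconcat (\<lambda>v. A (Suc q) (k # l # v)) (B 0) w =
          c * (deconcat (\<lambda>v. A q (k # l # v)) (B 0) w - deconcat (\<lambda>v. A (Suc q) ((k + l) # v)) (B 0) w)"
        unfolding A[of "Suc q"] by (simp add: deconcat_scale_diff)
      have "C (Suc q) (k # l # w) = c * (C q (k # l # w) - C (Suc q) ((k + l) # w))"
        by (simp add: C[of "Suc q"])
      also have "\<dots> = c * ((\<Sum>j<q. A j [] * B (q - j) (k # l # w)) + deconcat (A q) (B 0) (k # l # w) -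
          ((\<Sum>j<Suc q. A j [] * B (Suc q - j) ((k + l) # w)) + deconcat (A (Suc q)) (B 0) ((k + l) # w)))"
        using Merge(3,4) Suc by (simp del: deconcat_Cons)
      also have "\<dots> = (\<Sum>j<Suc q. A j [] * B (Suc q - j) (k # l # w)) + deconcat (A (Suc q)) (B 0) (k # l # w)"
        unfolding sum by (simp add: tail single[of "Suc q"] B[of 0 l w]) (simp add: algebra_simps)
      finally show ?thesis using Suc by (simp del: deconcat_Cons)
    qed
  qed
qed

theorem Gamma_coeff_cocycle:
  "deconcat (Gamma_coeff \<omega> \<tau>1 \<theta>1 \<theta>0) (Gamma_coeff \<omega> \<tau>2 \<theta>2 \<theta>1) w
    = Gamma_coeff \<omega> (\<tau>1 + \<tau>2) \<theta>2 \<theta>0 w"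
  using Gamma_coeff0_cocycle[where r = 0, of \<omega> \<tau>1 \<theta>1 \<theta>0 \<tau>2 \<theta>2 w]
  by (simp add: Gamma_coeff_def[abs_def])


section \<open>Derivatives of the coefficients along characteristic lines\<close>

lemma has_vector_derivative_cis_line:
  "((\<lambda>t. cis (kdot k (\<theta> + t *\<^sub>R \<omega>))) has_vector_derivative \<i> * kdot k \<omega> * cis (kdot k (\<theta> + t *\<^sub>R \<omega>))) (at t)"
  unfolding kdot_line has_vector_derivative_def
  by (auto intro!: derivative_eq_intros simp: scaleR_conv_of_real mult_ac)

lemma has_vector_derivative_monomial:
  "((\<lambda>t. complex_of_real (t ^ Suc r / fact (Suc r))) has_vector_derivative of_real (t ^ r / fact r)) (at t)"
proof -
  have "((\<lambda>t. t ^ Suc r / fact (Suc r)) has_real_derivative t ^ r / fact r) (at t)"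
    by (auto intro!: derivative_eq_intros simp del: power_Suc)
  then show ?thesis
    by (intro has_vector_derivative_of_real) (simp add: has_real_derivative_iff_has_vector_derivative)
qed

text \<open>
  When the end point moves along the flow of \<open>\<omega>\<close>, only the last letter is differentiated, as for
  iterated integrals. Nonresonance ensures that the denominators \<open>k\<cdot>\<omega>\<close> cancel the factors produced
  by differentiating the phases.
\<close>

lemma Gamma_coeff0_forward:
  fixes \<omega> \<theta> :: "real ^ 'd::finite"
  assumes \<omega>: "nonresonant \<omega>"
  defines "H \<equiv> \<lambda>r w t. Gamma_coeff0 \<omega> t (\<theta> + t *\<^sub>R \<omega>) \<theta> r w"
  shows "(H r w has_vector_derivative
    (if w = [] then if r = 0 then 0 else H (r - 1) [] t
     else H r (butlast w) t * cis (kdot (last w) (\<theta> + t *\<^sub>R \<omega>)))) (at t)"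
    (is "(_ has_vector_derivative ?D r w) _")
proof (induction r w rule: Gamma_coeff0_induct)
  case (Nil r)
  have "H r [] = (\<lambda>t. of_real (t ^ r / fact r))" for r by (simp add: H_def fun_eq_iff)
  then show ?case using has_vector_derivative_monomial[of "r - 1"] by (cases r) auto
next
  case (Zero r w)
  have "H r (0 # v) = H (Suc r) v" for v by (simp add: H_def fun_eq_iff)
  with Zero show ?case by (cases "w = []") auto
next
  case (Single r k)
  have kw: "kdot k \<omega> \<noteq> 0" using \<omega> Single by (simp add: nonresonant_def)
  define c where "c = \<i> / complex_of_real (kdot k \<omega>)"
  let ?e = "\<lambda>t. cis (kdot k (\<theta> + t *\<^sub>R \<omega>))"
  have eq: "H r [k] = (\<lambda>t. c * ((if r = 0 then cis (kdot k \<theta>) else H (r - 1) [k] t) - H r [] t * ?e t))"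
    unfolding H_def c_def by (rule ext) (rule Gamma_coeff0_single[OF Single(1)])
  have first: "((\<lambda>t. if r = 0 then cis (kdot k \<theta>) else H (r - 1) [k] t) has_vector_derivative
      (if r = 0 then 0 else H (r - 1) [] t * ?e t)) (at t)"
    using Single(3) by (cases "r = 0") auto
  have "(H r [k] has_vector_derivative c * ((if r = 0 then 0 else H (r - 1) [] t * ?e t) -
      (H r [] t * (\<i> * kdot k \<omega> * ?e t) + ?D r [] * ?e t))) (at t)"
    unfolding eq
    by (intro has_vector_derivative_mult_right has_vector_derivative_diff has_vector_derivative_mult first
        has_vector_derivative_cis_line Single(2))
  moreover have "c * (\<i> * kdot k \<omega>) = - 1" using kw by (simp add: c_def)
  then have "c * (H r [] t * (\<i> * kdot k \<omega> * ?e t)) = - H r [] t * ?e t"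
    by (metis (no_types, lifting) mult.assoc mult.commute mult_minus_left mult_1)
  then have "c * ((if r = 0 then 0 else H (r - 1) [] t * ?e t) -
      (H r [] t * (\<i> * kdot k \<omega> * ?e t) + ?D r [] * ?e t)) = ?D r [k]"
    by (simp add: ring_distribs)
  ultimately show ?case by simp
next
  case (Merge r k l w)
  define c where "c = \<i> / complex_of_real (kdot k \<omega>)"
  have eq: "H r (k # l # v) = (\<lambda>t. c * ((if r = 0 then cis (kdot k \<theta>) * H 0 (l # v) t else H (r - 1) (k # l # v) t)
     - H r ((k + l) # v) t))" for r v
    unfolding H_def c_def by (rule ext) (rule Gamma_coeff0_merge[OF Merge(1)])
  have eq1: "H r [k] = (\<lambda>t. c * ((if r = 0 then cis (kdot k \<theta>) else H (r - 1) [k] t) - H r [] t * cis (kdot k (\<theta> + t *\<^sub>R \<omega>))))" for r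
    unfolding H_def c_def by (rule ext) (rule Gamma_coeff0_single[OF Merge(1)])
  have first: "((\<lambda>t. if r = 0 then cis (kdot k \<theta>) * H 0 (l # w) t else H (r - 1) (k # l # w) t) has_vector_derivative
      (if r = 0 then cis (kdot k \<theta>) * ?D 0 (l # w) else ?D (r - 1) (k # l # w))) (at t)"
    using Merge(2,3) by (cases "r = 0") (auto intro: has_vector_derivative_mult_right)
  have "(H r (k # l # w) has_vector_derivative
     c * ((if r = 0 then cis (kdot k \<theta>) * ?D 0 (l # w) else ?D (r - 1) (k # l # w)) - ?D r ((k + l) # w))) (at t)"
    unfolding eq[of r w]
    by (intro has_vector_derivative_mult_right has_vector_derivative_diff first Merge(4))
  also have "c * ((if r = 0 then cis (kdot k \<theta>) * ?D 0 (l # w) else ?D (r - 1) (k # l # w)) - ?D r ((k + l) # w))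
     = ?D r (k # l # w)"
  proof (cases "w = []")
    case True
    have "H 0 [] t = 1" by (simp add: H_def)
    with True show ?thesis
      by (simp add: fun_cong[OF eq1[of r]] kdot_add cis_mult[symmetric]) (simp add: algebra_simps)
  next
    case False
    then show ?thesis
      by (simp add: fun_cong[OF eq[of r "butlast w"]]) (simp add: algebra_simps)
  qed
  finally show ?case .
qed

text \<open>
  Moving the starting point backwards differentiates the first letter instead. A block of a word
  grows at its front when the derivation of a new first letter is applied, so it is this form that
  matches the recursion for block sums below.
\<close>

lemma Gamma_coeff0_backward:
  fixes \<omega> \<theta> :: "real ^ 'd::finite"
  assumes \<omega>: "nonresonant \<omega>"
  defines "H \<equiv> \<lambda>r w t. Gamma_coeff0 \<omega> t \<theta> (\<theta> + t *\<^sub>R (- \<omega>)) r w"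
  shows "(H r w has_vector_derivative
    (if r = 0 then case w of [] \<Rightarrow> 0 | k # v \<Rightarrow> cis (kdot k (\<theta> + t *\<^sub>R (- \<omega>))) * H 0 v t
     else H (r - 1) w t)) (at t)"
    (is "(_ has_vector_derivative ?D r w) _")
proof (induction r w rule: Gamma_coeff0_induct)
  case (Nil r)
  have "H r [] = (\<lambda>t. of_real (t ^ r / fact r))" for r by (simp add: H_def fun_eq_iff)
  then show ?case using has_vector_derivative_monomial[of "r - 1"] by (cases r) auto
next
  case (Zero r w)
  have "H r (0 # v) = H (Suc r) v" for r v by (simp add: H_def fun_eq_iff)
  with Zero show ?case by (cases r) simp_all
next
  case (Single r k)
  have kw: "kdot k \<omega> \<noteq> 0" using \<omega> Single by (simp add: nonresonant_def)
  define c where "c = \<i> / complex_of_real (kdot k \<omega>)"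
  let ?e = "\<lambda>t. cis (kdot k (\<theta> + t *\<^sub>R (- \<omega>)))"
  have eq: "H r [k] = (\<lambda>t. c * ((if r = 0 then ?e t else H (r - 1) [k] t) - H r [] t * cis (kdot k \<theta>)))" for r
    unfolding H_def c_def by (rule ext) (rule Gamma_coeff0_single[OF Single(1)])
  \<comment> \<open>For \<open>r = 0\<close> the phase at the moving starting point contributes; its factor \<open>- i k\<cdot>\<omega>\<close> cancels the denominator.\<close>
  have first: "((\<lambda>t. if r = 0 then ?e t else H (r - 1) [k] t) has_vector_derivative
      (if r = 0 then \<i> * kdot k (- \<omega>) * ?e t else ?D (r - 1) [k])) (at t)"
    using Single(3) has_vector_derivative_cis_line[of k \<theta> "- \<omega>"] by (cases "r = 0") auto
  have "(H r [k] has_vector_derivative c * ((if r = 0 then \<i> * kdot k (- \<omega>) * ?e t else ?D (r - 1) [k]) -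
      ?D r [] * cis (kdot k \<theta>))) (at t)"
    unfolding eq[of r]
    by (intro has_vector_derivative_mult_right has_vector_derivative_diff has_vector_derivative_mult_left first
        Single(2))
  also have "c * ((if r = 0 then \<i> * kdot k (- \<omega>) * ?e t else ?D (r - 1) [k]) -
      ?D r [] * cis (kdot k \<theta>)) = ?D r [k]"
  proof (cases r)
    case 0
    have "c * (\<i> * kdot k (- \<omega>)) = 1" using kw by (simp add: c_def kdot_minus)
    moreover have "H 0 [] t = 1" by (simp add: H_def)
    ultimately show ?thesis using 0 by (simp flip: mult.assoc)
  next
    case (Suc q)
    have "H 0 [] t = 1" by (simp add: H_def)
    with Suc show ?thesis by (simp add: fun_cong[OF eq[of q]])
  qed
  finally show ?case .
next
  case (Merge r k l w)
  have kw: "kdot k \<omega> \<noteq> 0" using \<omega> Merge by (simp add: nonresonant_def)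
  define c where "c = \<i> / complex_of_real (kdot k \<omega>)"
  let ?e = "\<lambda>k t. cis (kdot k (\<theta> + t *\<^sub>R (- \<omega>)))"
  have eq: "H r (k # l # v) = (\<lambda>t. c * ((if r = 0 then ?e k t * H 0 (l # v) t else H (r - 1) (k # l # v) t)
     - H r ((k + l) # v) t))" for r v
    unfolding H_def c_def by (rule ext) (rule Gamma_coeff0_merge[OF Merge(1)])
  have first: "((\<lambda>t. if r = 0 then ?e k t * H 0 (l # w) t else H (r - 1) (k # l # w) t) has_vector_derivative
      (if r = 0 then ?e k t * ?D 0 (l # w) + \<i> * kdot k (- \<omega>) * ?e k t * H 0 (l # w) t else ?D (r - 1) (k # l # w))) (at t)"
    using Merge(2,3) has_vector_derivative_mult[OF has_vector_derivative_cis_line[of k \<theta> "- \<omega>" t], of "H 0 (l # w)"]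
    by (cases "r = 0") auto
  have "(H r (k # l # w) has_vector_derivative
     c * ((if r = 0 then ?e k t * ?D 0 (l # w) + \<i> * kdot k (- \<omega>) * ?e k t * H 0 (l # w) t else ?D (r - 1) (k # l # w)) - ?D r ((k + l) # w))) (at t)"
    unfolding eq[of r w]
    by (intro has_vector_derivative_mult_right has_vector_derivative_diff first Merge(4))
  also have "c * ((if r = 0 then ?e k t * ?D 0 (l # w) + \<i> * kdot k (- \<omega>) * ?e k t * H 0 (l # w) t else ?D (r - 1) (k # l # w)) - ?D r ((k + l) # w))
     = ?D r (k # l # w)"
  proof (cases r)
    case 0
    have "c * (\<i> * kdot k (- \<omega>)) = 1" using kw by (simp add: c_def kdot_minus)
    then show ?thesis using 0 by (simp add: kdot_add cis_mult[symmetric])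
  next
    case (Suc q)
    then show ?thesis by (simp add: fun_cong[OF eq[of q]])
  qed
  finally show ?case .
qed


lemma Gamma_coeff_forward:
  assumes "nonresonant \<omega>"
  shows "((\<lambda>s. Gamma_coeff \<omega> (s - t0) (s *\<^sub>R \<omega>) (t0 *\<^sub>R \<omega>) w) has_vector_derivative
    (if w = [] then 0 else Gamma_coeff \<omega> (s - t0) (s *\<^sub>R \<omega>) (t0 *\<^sub>R \<omega>) (butlast w) * cis (kdot (last w) (s *\<^sub>R \<omega>)))) (at s)"
proof -
  have line: "t0 *\<^sub>R \<omega> + (s - t0) *\<^sub>R \<omega> = s *\<^sub>R \<omega>" for s by (simp add: scaleR_left_diff_distrib)
  have "((\<lambda>s. s - t0) has_vector_derivative 1) (at s)"
    by (auto intro!: derivative_eq_intros)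
  from vector_diff_chain_at[OF this Gamma_coeff0_forward[OF assms, where r = 0 and w = w and \<theta> = "t0 *\<^sub>R \<omega>" and t = "s - t0"]]
  show ?thesis by (simp add: o_def line Gamma_coeff_def cong: if_cong)
qed

lemma alpha_eq_Gamma_coeff:
  fixes \<omega> :: "real ^ 'd::finite"
  assumes "nonresonant \<omega>"
  shows "alpha \<omega> t0 t w = Gamma_coeff \<omega> (t - t0) (t *\<^sub>R \<omega>) (t0 *\<^sub>R \<omega>) w"
proof -
  let ?G = "\<lambda>w s. Gamma_coeff \<omega> (s - t0) (s *\<^sub>R \<omega>) (t0 *\<^sub>R \<omega>) w"
  have "iterated_integral \<omega> t0 ks t = ?G (rev ks) t" for ks t
  proof (induction ks arbitrary: t)
    case Nil
    show ?case by (simp add: Gamma_coeff_def)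
  next
    case (Cons k ks)
    have d: "(?G (rev (k # ks)) has_vector_derivative cis (kdot k \<omega> * s) * ?G (rev ks) s) (at s)" for s
      using Gamma_coeff_forward[OF assms, of t0 "rev (k # ks)" s] by (simp add: kdot_scale mult.commute)
    have c: "continuous_on S (\<lambda>s. ?G v s)" for S v
      using Gamma_coeff_forward[OF assms, of t0 v] has_vector_derivative_continuous
      by (blast intro: continuous_at_imp_continuous_on)
    have "(LBINT s=t0..t. cis (kdot k \<omega> * s) * ?G (rev ks) s) = ?G (rev (k # ks)) t - ?G (rev (k # ks)) t0"
    proof (rule interval_integral_FTC_finite)
      have "continuous_on S (\<lambda>s. cis (kdot k \<omega> * s))" for S
        unfolding cis_conv_exp by (intro continuous_intros)
      then show "continuous_on {min t0 t..max t0 t} (\<lambda>s. cis (kdot k \<omega> * s) * ?G (rev ks) s)"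
        by (intro continuous_on_mult c)
    qed (rule has_vector_derivative_at_within[OF d])
    also have "?G (rev (k # ks)) t0 = 0"
      by (simp add: Gamma_coeff_def Gamma_coeff0_initial)
    finally show ?case by (simp add: Cons.IH)
  qed
  then show ?thesis by (simp add: alpha_def)
qed


section \<open>Quasi-polynomials and density of characteristic lines\<close>

lemma pderiv_plus_scale_eq_0:
  fixes p :: "complex poly"
  assumes "pderiv p + smult c p = 0" "c \<noteq> 0"
  shows "p = 0"
proof (rule ccontr)
  assume "p \<noteq> 0"
  have e: "smult c p = - pderiv p" using assms(1) by (simp add: eq_neg_iff_add_eq_0 add.commute)
  then have "degree p = degree (pderiv p)" using assms(2) by (metis degree_minus degree_smult_eq)
  then have "degree p = 0" by (simp add: degree_pderiv)
  then have "pderiv p = 0" by (simp add: pderiv_eq_0_iff)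
  with e assms(2) \<open>p \<noteq> 0\<close> show False by simp
qed

lemma poly_zero_on_reals:
  fixes p :: "complex poly"
  assumes "\<And>t :: real. poly p (of_real t) = 0"
  shows "p = 0"
proof (rule ccontr)
  assume "p \<noteq> 0"
  then have "finite {x. poly p x = 0}" by (rule poly_roots_finite)
  moreover have "range complex_of_real \<subseteq> {x. poly p x = 0}" using assms by auto
  ultimately have "finite (range complex_of_real)" by (rule rev_finite_subset)
  then show False by (simp add: finite_image_iff inj_of_real infinite_UNIV_char_0)
qed

lemma has_vector_derivative_poly_cis:
  "((\<lambda>t. poly p (of_real t) * cis (a * t)) has_vector_derivative
     poly (pderiv p + smult (\<i> * of_real a) p) (of_real t) * cis (a * t)) (at t)"
proof -
  have "((\<lambda>t. poly p (of_real t)) has_vector_derivative poly (pderiv p) (of_real t)) (at t)"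
    using has_vector_derivative_real_field[OF poly_DERIV[of p "of_real t"]] by simp
  moreover have "((\<lambda>t. cis (a * t)) has_vector_derivative \<i> * of_real a * cis (a * t)) (at t)"
    unfolding has_vector_derivative_def by (auto intro!: derivative_eq_intros simp: scaleR_conv_of_real mult_ac)
  ultimately show ?thesis
    by (auto intro: has_vector_derivative_eq_rhs[OF has_vector_derivative_mult] simp: algebra_simps)
qed

text \<open>
  After division by one of the exponentials, differentiation lowers the degree of its polynomial
  coefficient and acts on every other coefficient by a map \<open>p \<mapsto> p' + c p\<close> with \<open>c \<noteq> 0\<close>, which is
  injective. Induction on that degree thus removes the exponential.
\<close>

lemma exponential_polynomials_independent:
  fixes p :: "'i \<Rightarrow> complex poly" and f :: "'i \<Rightarrow> real"
  assumes "finite K" "inj_on f K" "\<And>t. (\<Sum>k\<in>K. poly (p k) (of_real t) * cis (f k * t)) = 0"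
  shows "\<forall>k\<in>K. p k = 0"
  using assms
proof (induction K arbitrary: p f rule: finite_induct)
  case empty
  then show ?case by simp
next
  case (insert a K)
  define g where "g = (\<lambda>k. f k - f a)"
  have g: "inj_on g K" "\<And>k. k \<in> K \<Longrightarrow> g k \<noteq> 0"
    using insert.prems(1) insert.hyps(2) by (auto simp: g_def inj_on_def)
  define d where "d = (\<lambda>q k. pderiv (q k) + smult (\<i> * of_real (g k)) (q k))"
  have derived: "poly (pderiv (q a)) (of_real t) + (\<Sum>k\<in>K. poly (d q k) (of_real t) * cis (g k * t)) = 0"
    if q: "\<And>t. poly (q a) (of_real t) + (\<Sum>k\<in>K. poly (q k) (of_real t) * cis (g k * t)) = 0" for q t
  proof -
    have "((\<lambda>t. poly (q a) (of_real t) * cis (0 * t) + (\<Sum>k\<in>K. poly (q k) (of_real t) * cis (g k * t))) has_vector_derivative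
        poly (pderiv (q a) + smult (\<i> * of_real 0) (q a)) (of_real t) * cis (0 * t) + (\<Sum>k\<in>K. poly (d q k) (of_real t) * cis (g k * t))) (at t)"
      unfolding d_def by (intro has_vector_derivative_add has_vector_derivative_sum has_vector_derivative_poly_cis)
    then have "((\<lambda>t. 0 :: complex) has_vector_derivative
        poly (pderiv (q a)) (of_real t) + (\<Sum>k\<in>K. poly (d q k) (of_real t) * cis (g k * t))) (at t)"
      by (simp add: q)
    from vector_derivative_unique_at[OF this has_vector_derivative_const] show ?thesis .
  qed
  have reduce: "\<forall>k\<in>insert a K. q k = 0"
    if q: "\<And>t. poly (q a) (of_real t) + (\<Sum>k\<in>K. poly (q k) (of_real t) * cis (g k * t)) = 0"
      and dq: "\<forall>k\<in>K. d q k = 0" for q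
  proof -
    have K: "\<forall>k\<in>K. q k = 0"
    proof
      fix k assume "k \<in> K"
      then show "q k = 0" using dq g(2) pderiv_plus_scale_eq_0[of "q k" "\<i> * of_real (g k)"] by (auto simp: d_def)
    qed
    moreover have "q a = 0" by (rule poly_zero_on_reals) (use q K in simp)
    ultimately show ?thesis by simp
  qed
  have main: "\<forall>k\<in>insert a K. q k = 0"
    if "degree (q a) \<le> n" and "\<And>t. poly (q a) (of_real t) + (\<Sum>k\<in>K. poly (q k) (of_real t) * cis (g k * t)) = 0" for n q
    using that
  proof (induction n arbitrary: q)
    case (0 q)
    then have "pderiv (q a) = 0" by (simp add: pderiv_eq_0_iff)
    with derived[OF 0(2)] have "\<And>t. (\<Sum>k\<in>K. poly (d q k) (of_real t) * cis (g k * t)) = 0" by simp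
    from reduce[OF 0(2) insert.IH[OF g(1) this]] show ?case .
  next
    case (Suc n q)
    \<comment> \<open>The derived family has a coefficient of smaller degree at \<open>a\<close>, so the induction hypothesis applies to it.\<close>
    define q' where "q' = (d q)(a := pderiv (q a))"
    have q': "q' a = pderiv (q a)" "k \<in> K \<Longrightarrow> q' k = d q k" for k
      using insert.hyps(2) by (auto simp: q'_def)
    have "\<forall>k\<in>insert a K. q' k = 0"
    proof (rule Suc.IH)
      show "degree (q' a) \<le> n" using Suc.prems(1) by (simp add: q' degree_pderiv)
      show "poly (q' a) (of_real t) + (\<Sum>k\<in>K. poly (q' k) (of_real t) * cis (g k * t)) = 0" for t
        using derived[OF Suc.prems(2), of t] by (simp add: q' cong: sum.cong)
    qed
    then have "\<forall>k\<in>K. d q k = 0" using q'(2) by auto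
    from reduce[OF Suc.prems(2) this] show ?case .
  qed
  show ?case
  proof (rule main[OF order_refl])
    fix t
    have "0 = (\<Sum>k\<in>insert a K. poly (p k) (of_real t) * cis (f k * t)) * cis (- f a * t)"
      using insert.prems(2) by simp
    also have "\<dots> = (\<Sum>k\<in>insert a K. poly (p k) (of_real t) * cis (g k * t))"
      by (simp only: sum_distrib_right g_def mult.assoc cis_mult) (simp add: algebra_simps)
    also have "\<dots> = poly (p a) (of_real t) + (\<Sum>k\<in>K. poly (p k) (of_real t) * cis (g k * t))"
      using insert.hyps by (simp add: g_def)
    finally show "poly (p a) (of_real t) + (\<Sum>k\<in>K. poly (p k) (of_real t) * cis (g k * t)) = 0" by simp
  qed
qed

text \<open>
  Functions that are polynomial in time and trigonometric polynomials in the angles.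
\<close>

inductive quasi_polynomial :: "(real \<Rightarrow> real ^ 'd::finite \<Rightarrow> complex) \<Rightarrow> bool" where
  qp_const: "quasi_polynomial (\<lambda>\<tau> \<phi>. c)"
| qp_time: "quasi_polynomial (\<lambda>\<tau> \<phi>. of_real \<tau>)"
| qp_phase: "quasi_polynomial (\<lambda>\<tau> \<phi>. cis (kdot k \<phi>))"
| qp_add: "quasi_polynomial P \<Longrightarrow> quasi_polynomial Q \<Longrightarrow> quasi_polynomial (\<lambda>\<tau> \<phi>. P \<tau> \<phi> + Q \<tau> \<phi>)"
| qp_mult: "quasi_polynomial P \<Longrightarrow> quasi_polynomial Q \<Longrightarrow> quasi_polynomial (\<lambda>\<tau> \<phi>. P \<tau> \<phi> * Q \<tau> \<phi>)"

lemma qp_sum: "(\<And>i. i \<in> A \<Longrightarrow> quasi_polynomial (P i)) \<Longrightarrow> quasi_polynomial (\<lambda>\<tau> \<phi>. \<Sum>i\<in>A. P i \<tau> \<phi>)"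
  by (induction A rule: infinite_finite_induct) (auto intro: quasi_polynomial.intros)

lemma qp_prod_list: "(\<And>i. i \<in> set xs \<Longrightarrow> quasi_polynomial (P i)) \<Longrightarrow> quasi_polynomial (\<lambda>\<tau> \<phi>. \<Prod>i\<leftarrow>xs. P i \<tau> \<phi>)"
  by (induction xs) (auto intro: quasi_polynomial.intros)

lemma qp_diff: "quasi_polynomial P \<Longrightarrow> quasi_polynomial Q \<Longrightarrow> quasi_polynomial (\<lambda>\<tau> \<phi>. P \<tau> \<phi> - Q \<tau> \<phi>)"
  using qp_add[OF _ qp_mult[OF qp_const[of "-1"]], of P Q] by simp

lemma qp_power_time: "quasi_polynomial (\<lambda>\<tau> \<phi>. of_real (\<tau> ^ n / fact n))"
proof -
  have "quasi_polynomial (\<lambda>\<tau> \<phi>. of_real \<tau> ^ n)"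
    by (induction n) (auto intro: quasi_polynomial.intros)
  from qp_mult[OF this qp_const[of "1 / fact n"]] show ?thesis by simp
qed

lemma quasi_polynomial_normal_form:
  fixes P :: "real \<Rightarrow> real ^ 'd::finite \<Rightarrow> complex"
  assumes "quasi_polynomial P"
  shows "\<exists>K p. finite K \<and> (\<forall>\<tau> \<phi>. P \<tau> \<phi> = (\<Sum>k\<in>K. poly (p k) (of_real \<tau>) * cis (kdot k \<phi>)))"
  using assms
proof induction
  case (qp_const c)
  show ?case by (rule exI[of _ "{0}"], rule exI[of _ "\<lambda>_. [:c:]"]) simp
next
  case qp_time
  show ?case by (rule exI[of _ "{0}"], rule exI[of _ "\<lambda>_. [:0, 1:]"]) simp
next
  case (qp_phase k)
  show ?case by (rule exI[of _ "{k}"], rule exI[of _ "\<lambda>_. 1"]) simp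
next
  case (qp_add P Q)
  then obtain K p L q where K: "finite K" and P: "\<And>\<tau> \<phi>. P \<tau> \<phi> = (\<Sum>k\<in>K. poly (p k) (of_real \<tau>) * cis (kdot k \<phi>))"
    and L: "finite L" and Q: "\<And>\<tau> \<phi>. Q \<tau> \<phi> = (\<Sum>k\<in>L. poly (q k) (of_real \<tau>) * cis (kdot k \<phi>))" by blast
  define r where "r = (\<lambda>k. (if k \<in> K then p k else 0) + (if k \<in> L then q k else 0))"
  have "P \<tau> \<phi> + Q \<tau> \<phi> = (\<Sum>k\<in>K \<union> L. poly (r k) (of_real \<tau>) * cis (kdot k \<phi>))" for \<tau> \<phi>
  proof -
    have "P \<tau> \<phi> = (\<Sum>k\<in>K \<union> L. poly (if k \<in> K then p k else 0) (of_real \<tau>) * cis (kdot k \<phi>))"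
      unfolding P using K L by (intro sum.mono_neutral_cong_left) auto
    moreover have "Q \<tau> \<phi> = (\<Sum>k\<in>K \<union> L. poly (if k \<in> L then q k else 0) (of_real \<tau>) * cis (kdot k \<phi>))"
      unfolding Q using K L by (intro sum.mono_neutral_cong_left) auto
    ultimately show ?thesis by (simp only: r_def poly_add ring_distribs sum.distrib)
  qed
  with K L show ?case by (intro exI[of _ "K \<union> L"] exI[of _ r]) simp
next
  case (qp_mult P Q)
  then obtain K p L q where K: "finite K" and P: "\<And>\<tau> \<phi>. P \<tau> \<phi> = (\<Sum>k\<in>K. poly (p k) (of_real \<tau>) * cis (kdot k \<phi>))"
    and L: "finite L" and Q: "\<And>\<tau> \<phi>. Q \<tau> \<phi> = (\<Sum>k\<in>L. poly (q k) (of_real \<tau>) * cis (kdot k \<phi>))" by blast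
  define M where "M = (\<lambda>(k, l). k + l) ` (K \<times> L)"
  define r where "r = (\<lambda>m. \<Sum>k\<in>K. \<Sum>l\<in>L. if m = k + l then p k * q l else 0)"
  have "finite M" using K L by (simp add: M_def)
  moreover have "P \<tau> \<phi> * Q \<tau> \<phi> = (\<Sum>m\<in>M. poly (r m) (of_real \<tau>) * cis (kdot m \<phi>))" for \<tau> \<phi>
  proof -
    have "(\<Sum>m\<in>M. poly (r m) (of_real \<tau>) * cis (kdot m \<phi>)) =
       (\<Sum>m\<in>M. \<Sum>k\<in>K. \<Sum>l\<in>L. if m = k + l then poly (p k) (of_real \<tau>) * poly (q l) (of_real \<tau>) * cis (kdot (k + l) \<phi>) else 0)"
      unfolding r_def poly_sum sum_distrib_right by (intro sum.cong refl) simp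
    also have "\<dots> = (\<Sum>k\<in>K. \<Sum>m\<in>M. \<Sum>l\<in>L. if m = k + l then poly (p k) (of_real \<tau>) * poly (q l) (of_real \<tau>) * cis (kdot (k + l) \<phi>) else 0)"
      by (rule sum.swap)
    also have "\<dots> = (\<Sum>k\<in>K. \<Sum>l\<in>L. \<Sum>m\<in>M. if m = k + l then poly (p k) (of_real \<tau>) * poly (q l) (of_real \<tau>) * cis (kdot (k + l) \<phi>) else 0)"
      by (intro sum.cong refl sum.swap)
    also have "\<dots> = (\<Sum>k\<in>K. \<Sum>l\<in>L. poly (p k) (of_real \<tau>) * poly (q l) (of_real \<tau>) * cis (kdot (k + l) \<phi>))"
    proof (intro sum.cong refl)
      fix k l assume "k \<in> K" "l \<in> L"
      then have "k + l \<in> M" by (auto simp: M_def)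
      then show "(\<Sum>m\<in>M. if m = k + l then poly (p k) (of_real \<tau>) * poly (q l) (of_real \<tau>) * cis (kdot (k + l) \<phi>) else 0)
         = poly (p k) (of_real \<tau>) * poly (q l) (of_real \<tau>) * cis (kdot (k + l) \<phi>)"
        using \<open>finite M\<close> by simp
    qed
    also have "\<dots> = P \<tau> \<phi> * Q \<tau> \<phi>"
      unfolding P Q sum_product by (intro sum.cong refl) (simp add: kdot_add cis_mult[symmetric] mult_ac)
    finally show ?thesis by simp
  qed
  ultimately show ?case by (intro exI[of _ M] exI[of _ r]) simp
qed

text \<open>
  On the line the mode \<open>k\<close> becomes an exponential with frequency \<open>k\<cdot>\<omega>\<close>. Nonresonance makes these
  frequencies distinct, so that no cancellation between different modes is possible.
\<close>

theorem quasi_polynomial_zero_on_line: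
  assumes "quasi_polynomial P" and \<omega>: "nonresonant \<omega>" and line: "\<And>t. P t (\<theta> + t *\<^sub>R \<omega>) = 0"
  shows "P \<tau> \<phi> = 0"
proof -
  obtain K p where K: "finite K" and P: "\<And>\<tau> \<phi>. P \<tau> \<phi> = (\<Sum>k\<in>K. poly (p k) (of_real \<tau>) * cis (kdot k \<phi>))"
    using quasi_polynomial_normal_form[OF assms(1)] by blast
  have "\<forall>k\<in>K. smult (cis (kdot k \<theta>)) (p k) = 0"
  proof (rule exponential_polynomials_independent[OF K])
    show "inj_on (\<lambda>k. kdot k \<omega>) K"
    proof (rule inj_onI)
      fix k l assume that: "kdot k \<omega> = kdot l \<omega>"
      have "kdot (k - l) \<omega> = 0" using kdot_add[of "k - l" l \<omega>] that by simp
      then have "k - l = 0" using \<omega> unfolding nonresonant_def by blast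
      then show "k = l" by simp
    qed
    show "(\<Sum>k\<in>K. poly (smult (cis (kdot k \<theta>)) (p k)) (of_real t) * cis (kdot k \<omega> * t)) = 0" for t
    proof -
      have "(\<Sum>k\<in>K. poly (p k) (of_real t) * cis (kdot k (\<theta> + t *\<^sub>R \<omega>))) = 0"
        using line[of t] by (simp only: P)
      then show ?thesis by (simp add: kdot_line cis_mult[symmetric] mult_ac)
    qed
  qed
  then have "p k = 0" if "k \<in> K" for k using that by simp
  then show ?thesis unfolding P by simp
qed

lemma qp_Gamma_coeff0: "quasi_polynomial (\<lambda>\<tau> \<phi>. Gamma_coeff0 \<omega> \<tau> \<theta> \<phi> r w)"
proof (induction r w rule: Gamma_coeff0_induct)
  case (Nil r)
  then show ?case using qp_power_time[of r] by simp
next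
  case (Zero r w)
  then show ?case by simp
next
  case (Single r k)
  have first: "quasi_polynomial (\<lambda>\<tau> \<phi>. if r = 0 then cis (kdot k \<phi>) else Gamma_coeff0 \<omega> \<tau> \<theta> \<phi> (r - 1) [k])"
    using Single(3) by (cases "r = 0") (simp_all add: qp_phase)
  show ?case unfolding Gamma_coeff0_single[OF Single(1), where r = r]
    by (rule qp_mult[OF qp_const], rule qp_diff, rule first, rule qp_mult[OF Single(2) qp_const])
next
  case (Merge r k l w)
  have first: "quasi_polynomial (\<lambda>\<tau> \<phi>. if r = 0 then cis (kdot k \<phi>) * Gamma_coeff0 \<omega> \<tau> \<theta> \<phi> 0 (l # w)
      else Gamma_coeff0 \<omega> \<tau> \<theta> \<phi> (r - 1) (k # l # w))"
    using Merge(3) qp_mult[OF qp_phase Merge(2)] by (cases "r = 0") (simp_all del: Gamma_coeff0.simps)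
  show ?case unfolding Gamma_coeff0_merge[OF Merge(1), where r = r and l = l and w = w]
    by (rule qp_mult[OF qp_const], rule qp_diff, rule first, rule Merge(4))
qed


section \<open>Sums over partitions of a word into blocks\<close>

text \<open>
  A multiset of words stands for the blocks of a partition of the positions of a word. A new first
  letter either becomes a block of its own or is put in front of one of the blocks.
\<close>

definition add_letter :: "'l \<Rightarrow> ('l list multiset \<Rightarrow> 'a::comm_monoid_add) \<Rightarrow> 'l list multiset \<Rightarrow> 'a" where
  "add_letter l \<Phi> U = \<Phi> (add_mset [l] U) + (\<Sum>w\<in>#U. \<Phi> (add_mset (l # w) (U - {#w#})))"

text \<open>
  The sum of \<open>\<Phi>\<close> over the partitions of the positions of a word into nonempty subwords. The argument
  \<open>\<Phi>\<close> accumulates the letters already treated, just as a differential operator accumulates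
  derivatives.
\<close>

primrec block_sum :: "'l list \<Rightarrow> ('l list multiset \<Rightarrow> 'a::comm_monoid_add) \<Rightarrow> 'a" where
  "block_sum [] \<Phi> = \<Phi> {#}"
| "block_sum (l # x) \<Phi> = block_sum x (add_letter l \<Phi>)"

definition block_lists :: "'l multiset \<Rightarrow> 'l list list set" where
  "block_lists N = {ws. [] \<notin> set ws \<and> sum_list (map mset ws) = N}"

text \<open>
  The grade \<open>N\<close> of \<open>\<Sum>\<^sub>m 1/m! \<Sum>\<^bsub>w\<^sub>1,\<dots>,w\<^sub>m\<^esub> \<delta>\<^bsub>w\<^sub>1\<^esub> \<cdots> \<delta>\<^bsub>w\<^sub>m\<^esub> \<Phi>{w\<^sub>1,\<dots>,w\<^sub>m}\<close> over nonempty words, that is, of a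
  Taylor series in \<open>W\<^sub>\<delta>(y) - y\<close> if \<open>\<delta>\<close> is 1 at the empty word.
\<close>

definition exp_sum :: "('l list \<Rightarrow> complex) \<Rightarrow> 'l multiset \<Rightarrow> ('l list multiset \<Rightarrow> complex) \<Rightarrow> complex" where
  "exp_sum \<delta> N \<Phi> = (\<Sum>ws\<in>block_lists N. prod_list (map \<delta> ws) / fact (length ws) * \<Phi> (mset ws))"

lemma finite_map_mset: "finite {ws. map mset ws = As}"
proof (induction As)
  case (Cons A As)
  have "{ws. map mset ws = A # As} = (\<lambda>(w, ws). w # ws) ` ({w. mset w = A} \<times> {ws. map mset ws = As})"
    by (auto simp: map_eq_Cons_conv)
  then show ?case using Cons by (simp add: finite_words_of_grade)
qed simp

lemma finite_block_lists: "finite (block_lists N)"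
proof -
  have "block_lists N = (\<Union>As\<in>{As. {#} \<notin> set As \<and> sum_list As = N}. {ws. map mset ws = As})"
    by (auto simp: block_lists_def)
  then show ?thesis by (simp add: finite_grade_decompositions finite_map_mset)
qed

lemma block_lists_empty: "block_lists {#} = {[]}"
proof -
  have "ws = []" if "ws \<in> block_lists {#}" for ws :: "'l list list"
    using that by (cases ws) (auto simp: block_lists_def)
  then show ?thesis by (auto simp: block_lists_def)
qed

lemma sum_words_Cons:
  assumes "N \<noteq> {#}"
  shows "(\<Sum>x | mset x = N. h x) = (\<Sum>k\<in>set_mset N. \<Sum>v | mset v = N - {#k#}. h (k # v))"
proof -
  have "(\<Sum>k\<in>set_mset N. \<Sum>v | mset v = N - {#k#}. h (k # v)) =
     (\<Sum>(k, v)\<in>(SIGMA k:set_mset N. {v. mset v = N - {#k#}}). h (k # v))"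
    by (rule sum.Sigma) (auto simp: finite_words_of_grade)
  also have "\<dots> = (\<Sum>x | mset x = N. h x)"
    by (rule sum.reindex_bij_witness[where j = "\<lambda>(k, v). k # v" and i = "\<lambda>x. (hd x, tl x)"])
       (use assms in \<open>auto simp: neq_Nil_conv split: list.splits\<close>)
  finally show ?thesis by simp
qed

lemma has_vector_derivative_prod_list:
  fixes f :: "real \<Rightarrow> 'b \<Rightarrow> complex"
  assumes "\<And>w. w \<in> set ws \<Longrightarrow> ((\<lambda>t. f t w) has_vector_derivative f' w) (at t)"
  shows "((\<lambda>t. prod_list (map (f t) ws)) has_vector_derivative
    (\<Sum>i<length ws. prod_list (map (f t) (take i ws)) * f' (ws ! i) * prod_list (map (f t) (drop (Suc i) ws)))) (at t)"
  using assms
proof (induction ws)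
  case (Cons w ws)
  have "((\<lambda>t. f t w * prod_list (map (f t) ws)) has_vector_derivative
     f t w * (\<Sum>i<length ws. prod_list (map (f t) (take i ws)) * f' (ws ! i) * prod_list (map (f t) (drop (Suc i) ws)))
      + f' w * prod_list (map (f t) ws)) (at t)"
    by (intro has_vector_derivative_mult Cons.IH Cons.prems) auto
  then show ?case
    by (simp add: sum.lessThan_Suc_shift sum_distrib_left mult.assoc add.commute del: sum.lessThan_Suc)
qed simp

lemma grade_split_nth:
  assumes "i < length ws"
  shows "sum_list (map mset ws) = sum_list (map mset (take i ws)) + mset (ws ! i) + sum_list (map mset (drop (Suc i) ws))"
  by (subst id_take_nth_drop[OF assms]) (simp add: add.assoc)

lemma grade_update:
  assumes "i < length ws"
  shows "sum_list (map mset (ws[i := v])) = sum_list (map mset (take i ws)) + mset v + sum_list (map mset (drop (Suc i) ws))"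
  by (subst upd_conv_take_nth_drop[OF assms]) (simp add: add.assoc)

lemma sum_mset_mset: "(\<Sum>w\<in>#mset vs. h w) = (\<Sum>i<length vs. h (vs ! i))"
  by (simp add: sum_mset_sum_list sum_list_sum_nth atLeast0LessThan flip: mset_map)

lemma exp_sum_add_letter:
  "exp_sum \<delta> N (add_letter k \<Phi>) =
     (\<Sum>vs\<in>block_lists N. prod_list (map \<delta> vs) / fact (length vs) * \<Phi> (add_mset [k] (mset vs))) +
     (\<Sum>vs\<in>block_lists N. \<Sum>i<length vs. prod_list (map \<delta> vs) / fact (length vs) * \<Phi> (mset (vs[i := k # vs ! i])))"
proof -
  have "(\<Sum>w\<in>#mset vs. \<Phi> (add_mset (k # w) (mset vs - {#w#}))) = (\<Sum>i<length vs. \<Phi> (mset (vs[i := k # vs ! i])))" for vs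
    unfolding sum_mset_mset by (intro sum.cong refl) (simp add: mset_update)
  then show ?thesis
    by (simp add: exp_sum_def add_letter_def ring_distribs sum.distrib sum_distrib_left)
qed

lemma sum_Sigma_triple:
  assumes "finite A" "\<And>a. finite (B a)" "\<And>a b. finite (C a b)"
  shows "(\<Sum>(a, b, c)\<in>(SIGMA a:A. SIGMA b:B a. C a b). h a b c) = (\<Sum>a\<in>A. \<Sum>b\<in>B a. \<Sum>c\<in>C a b. h a b c)"
  using assms by (subst sum.Sigma[symmetric]) (auto simp: sum.Sigma[symmetric] finite_SigmaI)

text \<open>
  Differentiating a block that consists of a single letter removes it. There are \<open>m + 1\<close> places
  where it can have stood in a list with \<open>m\<close> remaining blocks; this turns \<open>1/(m+1)!\<close> into \<open>1/m!\<close>.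
\<close>

lemma sum_singleton_blocks:
  assumes "\<delta> [] = (1 :: complex)"
  shows "(\<Sum>(ws, i) | ws \<in> block_lists N \<and> i < length ws \<and> tl (ws ! i) = [].
       e (hd (ws ! i)) * prod_list (map \<delta> (ws[i := tl (ws ! i)])) / fact (length ws) * \<Phi> (mset ws)) =
     (\<Sum>k\<in>set_mset N. e k * (\<Sum>vs\<in>block_lists (N - {#k#}).
       prod_list (map \<delta> vs) / fact (length vs) * \<Phi> (add_mset [k] (mset vs))))"
proof -
  let ?T = "SIGMA k:set_mset N. SIGMA vs:block_lists (N - {#k#}). {..length vs}"
  have "(\<Sum>(ws, i) | ws \<in> block_lists N \<and> i < length ws \<and> tl (ws ! i) = [].
       e (hd (ws ! i)) * prod_list (map \<delta> (ws[i := tl (ws ! i)])) / fact (length ws) * \<Phi> (mset ws)) =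
     (\<Sum>(k, vs, i)\<in>?T. e k * (prod_list (map \<delta> vs) / fact (Suc (length vs)) * \<Phi> (add_mset [k] (mset vs))))"
  proof (rule sum.reindex_bij_witness[where
        j = "\<lambda>(ws, i). (hd (ws ! i), take i ws @ drop (Suc i) ws, i)"
        and i = "\<lambda>(k, vs, i). (take i vs @ [k] # drop i vs, i)"], goal_cases)
    case (1 a)
    then obtain ws i where a: "a = (ws, i)" "ws \<in> block_lists N" "i < length ws" "tl (ws ! i) = []" by auto
    from a(2) nth_mem[OF a(3)] have "ws ! i \<noteq> []" by (auto simp: block_lists_def)
    with a have "[hd (ws ! i)] = ws ! i" by (metis list.collapse)
    with a show ?case by (simp add: id_take_nth_drop[symmetric] min_def)
  next
    case (2 a)
    then obtain ws i where a: "a = (ws, i)" "ws \<in> block_lists N" "i < length ws" "tl (ws ! i) = []" by auto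
    from a(2) nth_mem[OF a(3)] have "ws ! i \<noteq> []" by (auto simp: block_lists_def)
    with a have w: "ws ! i = [hd (ws ! i)]" by (metis list.collapse)
    then have "mset (ws ! i) = {#hd (ws ! i)#}" by (metis mset_single_iff)
    with a(2) grade_split_nth[OF a(3)]
    have "N = add_mset (hd (ws ! i)) (sum_list (map mset (take i ws @ drop (Suc i) ws)))"
      by (simp add: block_lists_def)
    then have "hd (ws ! i) \<in># N" "sum_list (map mset (take i ws @ drop (Suc i) ws)) = N - {#hd (ws ! i)#}"
      by auto
    moreover from this(2) have "take i ws @ drop (Suc i) ws \<in> block_lists (N - {#hd (ws ! i)#})"
      using a(2) by (auto simp: block_lists_def dest: in_set_takeD in_set_dropD)
    ultimately show ?case using a(1,3) by simp
  next
    case (3 b)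
    then show ?case by (auto simp: nth_append min_def)
  next
    case (4 b)
    then obtain k vs i where b: "b = (k, vs, i)" "k \<in># N" "vs \<in> block_lists (N - {#k#})" "i \<le> length vs" by auto
    then have "sum_list (map mset (take i vs)) + sum_list (map mset (drop i vs)) = N - {#k#}"
      by (metis (mono_tags, lifting) append_take_drop_id block_lists_def map_append mem_Collect_eq sum_list.append)
    with b show ?case
      by (auto simp: block_lists_def nth_append min_def dest: in_set_takeD in_set_dropD)
  next
    case (5 a)
    then obtain ws i where a: "a = (ws, i)" "ws \<in> block_lists N" "i < length ws" "tl (ws ! i) = []" by auto
    from a(2) nth_mem[OF a(3)] have "ws ! i \<noteq> []" by (auto simp: block_lists_def)
    with a have w: "ws ! i = [hd (ws ! i)]" by (metis list.collapse)
    have "mset ws = add_mset (ws ! i) (mset (take i ws @ drop (Suc i) ws))"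
      by (subst id_take_nth_drop[OF a(3)]) simp
    then have "mset ws = add_mset [hd (ws ! i)] (mset (take i ws @ drop (Suc i) ws))" using w by simp
    moreover have "Suc (length ws - Suc 0) = length ws" using a(3) by auto
    ultimately show ?case using a assms by (simp add: upd_conv_take_nth_drop min_def del: fact_Suc)
  qed
  also have "\<dots> = (\<Sum>k\<in>set_mset N. \<Sum>vs\<in>block_lists (N - {#k#}). \<Sum>i\<le>length vs.
       e k * (prod_list (map \<delta> vs) / fact (Suc (length vs)) * \<Phi> (add_mset [k] (mset vs))))"
    by (rule sum_Sigma_triple) (auto simp: finite_block_lists)
  also have "\<dots> = (\<Sum>k\<in>set_mset N. e k * (\<Sum>vs\<in>block_lists (N - {#k#}).
       prod_list (map \<delta> vs) / fact (length vs) * \<Phi> (add_mset [k] (mset vs))))"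
  proof -
    have "of_nat (Suc n) * (x * (y / fact (Suc n) * z)) = x * (y / fact n * z)" for n and x y z :: complex
      by (simp add: fact_Suc del: of_nat_Suc)
    then show ?thesis
      unfolding sum_distrib_left by (intro sum.cong refl) (simp del: fact_Suc of_nat_Suc)
  qed
  finally show ?thesis .
qed

lemma sum_longer_blocks:
  fixes \<delta> :: "'l list \<Rightarrow> complex"
  shows "(\<Sum>(ws, i) | ws \<in> block_lists N \<and> i < length ws \<and> tl (ws ! i) \<noteq> [].
       e (hd (ws ! i)) * prod_list (map \<delta> (ws[i := tl (ws ! i)])) / fact (length ws) * \<Phi> (mset ws)) =
     (\<Sum>k\<in>set_mset N. e k * (\<Sum>vs\<in>block_lists (N - {#k#}). \<Sum>i<length vs.
       prod_list (map \<delta> vs) / fact (length vs) * \<Phi> (mset (vs[i := k # vs ! i]))))"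
proof -
  let ?T = "SIGMA k:set_mset N. SIGMA vs:block_lists (N - {#k#}). {..<length vs}"
  have "(\<Sum>(ws, i) | ws \<in> block_lists N \<and> i < length ws \<and> tl (ws ! i) \<noteq> [].
       e (hd (ws ! i)) * prod_list (map \<delta> (ws[i := tl (ws ! i)])) / fact (length ws) * \<Phi> (mset ws)) =
     (\<Sum>(k, vs, i)\<in>?T. e k * (prod_list (map \<delta> vs) / fact (length vs) * \<Phi> (mset (vs[i := k # vs ! i]))))"
  proof (rule sum.reindex_bij_witness[where
        j = "\<lambda>(ws, i). (hd (ws ! i), ws[i := tl (ws ! i)], i)"
        and i = "\<lambda>(k, vs, i). (vs[i := k # vs ! i], i)"], goal_cases)
    case (1 a)
    then obtain ws i where a: "a = (ws, i)" "i < length ws" "tl (ws ! i) \<noteq> []" by auto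
    then have "ws ! i \<noteq> []" by auto
    with a show ?case by simp
  next
    case (2 a)
    then obtain ws i where a: "a = (ws, i)" "ws \<in> block_lists N" "i < length ws" "tl (ws ! i) \<noteq> []" by auto
    then have "ws ! i \<noteq> []" by auto
    then have "mset (ws ! i) = add_mset (hd (ws ! i)) (mset (tl (ws ! i)))" by (metis list.collapse mset.simps(2))
    with a(2) have "N = add_mset (hd (ws ! i)) (sum_list (map mset (ws[i := tl (ws ! i)])))"
      by (simp add: grade_split_nth[OF a(3)] grade_update[OF a(3)] block_lists_def)
    then have "hd (ws ! i) \<in># N" "sum_list (map mset (ws[i := tl (ws ! i)])) = N - {#hd (ws ! i)#}"
      by auto
    moreover from this(2) have "ws[i := tl (ws ! i)] \<in> block_lists (N - {#hd (ws ! i)#})"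
      using a(2,4) by (auto simp: block_lists_def dest: subsetD[OF set_update_subset_insert])
    ultimately show ?case using a(1,3) by simp
  next
    case (3 b)
    then show ?case by auto
  next
    case (4 b)
    then obtain k vs i where b: "b = (k, vs, i)" "k \<in># N" "vs \<in> block_lists (N - {#k#})" "i < length vs" by auto
    from b(3) nth_mem[OF b(4)] have "vs ! i \<noteq> []" by (auto simp: block_lists_def)
    with b grade_split_nth[OF b(4)] grade_update[OF b(4), of "k # vs ! i"] show ?case
      by (auto simp: block_lists_def dest: subsetD[OF set_update_subset_insert])
  next
    case (5 a)
    then obtain ws i where a: "a = (ws, i)" "i < length ws" "tl (ws ! i) \<noteq> []" by auto
    then have "ws ! i \<noteq> []" by auto
    with a show ?case by simp
  qed
  also have "\<dots> = (\<Sum>k\<in>set_mset N. e k * (\<Sum>vs\<in>block_lists (N - {#k#}). \<Sum>i<length vs.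
       prod_list (map \<delta> vs) / fact (length vs) * \<Phi> (mset (vs[i := k # vs ! i]))))"
    unfolding sum_distrib_left by (rule sum_Sigma_triple) (auto simp: finite_block_lists)
  finally show ?thesis .
qed

text \<open>
  By the product rule one block of each list loses its first letter. Recording that letter in \<open>\<Phi>\<close>
  instead, by \<open>add_letter\<close>, leaves the same kind of sum in a smaller grade.
\<close>

lemma has_vector_derivative_exp_sum:
  fixes \<delta> :: "real \<Rightarrow> 'l list \<Rightarrow> complex"
  assumes d: "\<And>k w. ((\<lambda>t. \<delta> t (k # w)) has_vector_derivative e k * \<delta> t w) (at t)"
    and nil: "\<delta> t [] = 1"
  shows "((\<lambda>t. exp_sum (\<delta> t) N \<Phi>) has_vector_derivative
    (\<Sum>k\<in>set_mset N. e k * exp_sum (\<delta> t) (N - {#k#}) (add_letter k \<Phi>))) (at t)"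
proof -
  let ?P = "\<lambda>ws i. prod_list (map (\<delta> t) (ws[i := tl (ws ! i)]))"
  have P: "((\<lambda>t. prod_list (map (\<delta> t) ws)) has_vector_derivative
      (\<Sum>i<length ws. e (hd (ws ! i)) * ?P ws i)) (at t)" if "ws \<in> block_lists N" for ws
  proof -
    have "((\<lambda>t. \<delta> t w) has_vector_derivative e (hd w) * \<delta> t (tl w)) (at t)" if "w \<in> set ws" for w
    proof -
      have "w \<noteq> []" using that \<open>ws \<in> block_lists N\<close> by (auto simp: block_lists_def)
      with d[of "hd w" "tl w"] show ?thesis by simp
    qed
    from has_vector_derivative_prod_list[OF this]
    have "((\<lambda>t. prod_list (map (\<delta> t) ws)) has_vector_derivative
      (\<Sum>i<length ws. prod_list (map (\<delta> t) (take i ws)) * (e (hd (ws ! i)) * \<delta> t (tl (ws ! i))) *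
         prod_list (map (\<delta> t) (drop (Suc i) ws)))) (at t)" .
    also have "(\<Sum>i<length ws. prod_list (map (\<delta> t) (take i ws)) * (e (hd (ws ! i)) * \<delta> t (tl (ws ! i))) *
         prod_list (map (\<delta> t) (drop (Suc i) ws))) = (\<Sum>i<length ws. e (hd (ws ! i)) * ?P ws i)"
      by (intro sum.cong refl) (simp add: upd_conv_take_nth_drop mult_ac)
    finally show ?thesis .
  qed
  have "((\<lambda>t. exp_sum (\<delta> t) N \<Phi>) has_vector_derivative
     (\<Sum>ws\<in>block_lists N. (\<Sum>i<length ws. e (hd (ws ! i)) * ?P ws i) / fact (length ws) * \<Phi> (mset ws))) (at t)"
    unfolding exp_sum_def
    by (intro has_vector_derivative_sum has_vector_derivative_mult_left has_vector_derivative_divide P)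
  also have "(\<Sum>ws\<in>block_lists N. (\<Sum>i<length ws. e (hd (ws ! i)) * ?P ws i) / fact (length ws) * \<Phi> (mset ws)) =
     (\<Sum>(ws, i)\<in>(SIGMA ws:block_lists N. {..<length ws}). e (hd (ws ! i)) * ?P ws i / fact (length ws) * \<Phi> (mset ws))"
    by (simp add: sum.Sigma[symmetric] finite_block_lists sum_divide_distrib sum_distrib_right)
  also have "\<dots> = (\<Sum>(ws, i) | ws \<in> block_lists N \<and> i < length ws \<and> tl (ws ! i) = [].
        e (hd (ws ! i)) * ?P ws i / fact (length ws) * \<Phi> (mset ws)) +
      (\<Sum>(ws, i) | ws \<in> block_lists N \<and> i < length ws \<and> tl (ws ! i) \<noteq> [].
        e (hd (ws ! i)) * ?P ws i / fact (length ws) * \<Phi> (mset ws))"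
    by (subst sum.union_disjoint[symmetric])
       (auto intro!: sum.cong finite_subset[OF _ finite_SigmaI[OF finite_block_lists[of N], of "\<lambda>ws. {..<length ws}"]])
  also have "\<dots> = (\<Sum>k\<in>set_mset N. e k * exp_sum (\<delta> t) (N - {#k#}) (add_letter k \<Phi>))"
    unfolding sum_singleton_blocks[of "\<delta> t", OF nil] sum_longer_blocks exp_sum_add_letter
    by (simp add: ring_distribs sum.distrib)
  finally show ?thesis .
qed

text \<open>
  Both sides satisfy the same differential equation in \<open>t\<close>, with a right-hand side in smaller
  grades, and vanish at \<open>t = 0\<close> in every grade except \<open>{#}\<close>.
\<close>

theorem exp_sum_eq_block_sum_line:
  fixes \<delta> :: "real \<Rightarrow> 'l list \<Rightarrow> complex"
  assumes d: "\<And>k w t. ((\<lambda>t. \<delta> t (k # w)) has_vector_derivative e k t * \<delta> t w) (at t)"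
    and nil: "\<And>t. \<delta> t [] = 1" and init: "\<And>k w. \<delta> 0 (k # w) = 0"
  shows "exp_sum (\<delta> t) N \<Phi> = (\<Sum>x | mset x = N. \<delta> t x * block_sum x \<Phi>)"
proof (induction "size N" arbitrary: N \<Phi> t)
  case 0
  then show ?case by (simp add: exp_sum_def block_lists_empty nil)
next
  case (Suc n)
  then have N: "N \<noteq> {#}" by auto
  let ?L = "\<lambda>t. exp_sum (\<delta> t) N \<Phi>" and ?R = "\<lambda>t. \<Sum>x | mset x = N. \<delta> t x * block_sum x \<Phi>"
  let ?d = "\<lambda>t. \<Sum>k\<in>set_mset N. e k t * exp_sum (\<delta> t) (N - {#k#}) (add_letter k \<Phi>)"
  have L: "(?L has_vector_derivative ?d t) (at t)" for t
    using has_vector_derivative_exp_sum[where e = "\<lambda>k. e k t" and t = t and \<delta> = \<delta>, OF d nil] .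
  have R: "(?R has_vector_derivative ?d t) (at t)" for t
  proof -
    have "(?R has_vector_derivative (\<Sum>k\<in>set_mset N. \<Sum>v | mset v = N - {#k#}. e k t * \<delta> t v * block_sum (k # v) \<Phi>)) (at t)"
      unfolding sum_words_Cons[OF N]
      by (intro has_vector_derivative_sum has_vector_derivative_mult_left d)
    also have "(\<Sum>k\<in>set_mset N. \<Sum>v | mset v = N - {#k#}. e k t * \<delta> t v * block_sum (k # v) \<Phi>) = ?d t"
    proof (intro sum.cong refl)
      fix k assume "k \<in> set_mset N"
      then have "n = size (N - {#k#})" using Suc(2) by (simp add: size_Diff_singleton)
      from Suc(1)[OF this] show "(\<Sum>v | mset v = N - {#k#}. e k t * \<delta> t v * block_sum (k # v) \<Phi>) =
         e k t * exp_sum (\<delta> t) (N - {#k#}) (add_letter k \<Phi>)"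
        by (simp add: sum_distrib_left mult.assoc)
    qed
    finally show ?thesis .
  qed
  have "((\<lambda>t. ?L t - ?R t) has_vector_derivative 0) (at t)" for t
    using has_vector_derivative_diff[OF L R] by simp
  then obtain c where c: "\<And>t. ?L t - ?R t = c"
    using has_vector_derivative_zero_constant[of UNIV "\<lambda>t. ?L t - ?R t"] by auto
  have "?L 0 = 0"
  proof -
    have "prod_list (map (\<delta> 0) ws) = 0" if in_N: "ws \<in> block_lists N" for ws
    proof -
      obtain w ws' where ws: "ws = w # ws'"
        using in_N N by (cases ws) (auto simp: block_lists_def)
      then have "w \<noteq> []" using in_N by (auto simp: block_lists_def)
      with ws show ?thesis by (cases w) (auto simp: init)
    qed
    then show ?thesis by (simp add: exp_sum_def)
  qed
  moreover have "?R 0 = 0"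
    unfolding sum_words_Cons[OF N] by (simp add: init)
  ultimately have "c = 0" using c[of 0] by simp
  with c[of t] show ?case by simp
qed

text \<open>
  An exponential formula for words, dual to the multiplicativity of iterated integrals under
  shuffles. It holds on a line in the space of all \<open>(\<tau>, \<theta>\<^sub>0)\<close> and extends from there, since both
  sides are quasi-polynomials.
\<close>

theorem Gamma_coeff_character:
  assumes "nonresonant \<omega>"
  shows "exp_sum (Gamma_coeff \<omega> \<tau> \<theta> \<theta>0) N \<Phi> = (\<Sum>x | mset x = N. Gamma_coeff \<omega> \<tau> \<theta> \<theta>0 x * block_sum x \<Phi>)"
proof -
  let ?P = "\<lambda>\<tau> \<phi>. exp_sum (Gamma_coeff \<omega> \<tau> \<theta> \<phi>) N \<Phi> - (\<Sum>x | mset x = N. Gamma_coeff \<omega> \<tau> \<theta> \<phi> x * block_sum x \<Phi>)"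
  have G: "quasi_polynomial (\<lambda>\<tau> \<phi>. Gamma_coeff \<omega> \<tau> \<theta> \<phi> w)" for w
    unfolding Gamma_coeff_def by (rule qp_Gamma_coeff0)
  have "quasi_polynomial (\<lambda>\<tau> \<phi>. \<Sum>ws\<in>block_lists N. prod_list (map (Gamma_coeff \<omega> \<tau> \<theta> \<phi>) ws) * (1 / fact (length ws) * \<Phi> (mset ws)))"
    by (rule qp_sum, rule qp_mult[OF qp_prod_list[OF G] qp_const])
  then have 1: "quasi_polynomial (\<lambda>\<tau> \<phi>. exp_sum (Gamma_coeff \<omega> \<tau> \<theta> \<phi>) N \<Phi>)"
    by (simp add: exp_sum_def)
  have 2: "quasi_polynomial (\<lambda>\<tau> \<phi>. \<Sum>x | mset x = N. Gamma_coeff \<omega> \<tau> \<theta> \<phi> x * block_sum x \<Phi>)"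
    by (rule qp_sum, rule qp_mult[OF G qp_const])
  have \<omega>': "nonresonant (- \<omega>)"
    using assms by (simp add: nonresonant_def kdot_minus)
  have "?P \<tau> \<theta>0 = 0"
  proof (rule quasi_polynomial_zero_on_line[OF qp_diff[OF 1 2] \<omega>'])
    fix t
    let ?\<delta> = "\<lambda>t. Gamma_coeff \<omega> t \<theta> (\<theta> + t *\<^sub>R (- \<omega>))"
    have "exp_sum (?\<delta> t) N \<Phi> = (\<Sum>x | mset x = N. ?\<delta> t x * block_sum x \<Phi>)"
    proof (rule exp_sum_eq_block_sum_line[where e = "\<lambda>k t. cis (kdot k (\<theta> + t *\<^sub>R (- \<omega>)))"])
      show "((\<lambda>t. ?\<delta> t (k # w)) has_vector_derivative cis (kdot k (\<theta> + t *\<^sub>R (- \<omega>))) * ?\<delta> t w) (at t)" for k w t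
        using Gamma_coeff0_backward[OF assms, where r = 0 and w = "k # w" and \<theta> = \<theta> and t = t]
        unfolding Gamma_coeff_def by (simp del: Gamma_coeff0.simps)
      show "?\<delta> t [] = 1" for t by (simp add: Gamma_coeff_def)
      show "?\<delta> 0 (k # w) = 0" for k w
        by (simp add: Gamma_coeff_def Gamma_coeff0_initial del: Gamma_coeff0.simps)
    qed
    then show "?P t (\<theta> + t *\<^sub>R (- \<omega>)) = 0" by simp
  qed
  then show ?thesis by simp
qed


section \<open>Smooth maps and their iterated derivatives\<close>

lemma has_derivative_frechet: "g differentiable (at x) \<Longrightarrow> (g has_derivative frechet_derivative g (at x)) (at x)"
  by (simp add: frechet_derivative_works)

lemma smooth_differentiable: "smooth g \<Longrightarrow> g differentiable (at x)"
  unfolding smooth_def by (metis differentiable_upto.simps(2))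

lemma smooth_has_derivative: "smooth g \<Longrightarrow> (g has_derivative frechet_derivative g (at x)) (at x)"
  by (simp add: has_derivative_frechet smooth_differentiable)

lemma smooth_continuous_on: "smooth g \<Longrightarrow> continuous_on S g"
  unfolding smooth_def by (metis differentiable_upto.simps(1) continuous_on_subset subset_UNIV)

lemma smooth_directional: "smooth g \<Longrightarrow> smooth (\<lambda>x. frechet_derivative g (at x) v)"
  unfolding smooth_def by (metis differentiable_upto.simps(2))

lemma frechet_eqI: "(g has_derivative g') (at x) \<Longrightarrow> frechet_derivative g (at x) = g'"
  by (rule frechet_derivative_at[symmetric])

text \<open>
  By the fundamental theorem of calculus \<open>g(x + s u) - g(x)\<close> is the integral of \<open>D\<^sub>u g\<close> over the
  segment. Differentiating under the integral sign in the direction \<open>v\<close> and then with respect to \<open>s\<close>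
  at \<open>s = 0\<close> gives the two orders of differentiation.
\<close>

lemma smooth_directional_symmetric:
  fixes g :: "'a::real_normed_vector \<Rightarrow> 'b::banach"
  assumes g: "smooth g"
  shows "frechet_derivative (\<lambda>y. frechet_derivative g (at y) u) (at x) v
       = frechet_derivative (\<lambda>y. frechet_derivative g (at y) v) (at x) u"
proof -
  define D where "D = (\<lambda>w y. frechet_derivative g (at y) w)"
  define DD where "DD = (\<lambda>y. frechet_derivative (D u) (at y) v)"
  have sD: "smooth (D w)" for w
    unfolding D_def using g by (rule smooth_directional)
  have sDD: "smooth DD"
    unfolding DD_def by (rule smooth_directional[OF sD])
  have dir: "((\<lambda>t. h (p + t *\<^sub>R w)) has_vector_derivative frechet_derivative h (at (p + t *\<^sub>R w)) w) (at t within T)"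
    if "smooth h" for h :: "'a \<Rightarrow> 'b" and p w t T
  proof -
    have "((\<lambda>t. h (p + t *\<^sub>R w)) has_derivative (\<lambda>s. frechet_derivative h (at (p + t *\<^sub>R w)) (s *\<^sub>R w))) (at t within T)"
      by (rule has_derivative_compose[OF _ smooth_has_derivative[OF that]]) (auto intro!: derivative_eq_intros)
    moreover have "frechet_derivative h (at (p + t *\<^sub>R w)) (s *\<^sub>R w) = s *\<^sub>R frechet_derivative h (at (p + t *\<^sub>R w)) w" for s
      using linear_frechet_derivative[OF smooth_differentiable[OF that]] by (simp add: linear_iff)
    ultimately show ?thesis by (simp add: has_vector_derivative_def)
  qed
  have eq: "D v (x + s *\<^sub>R u) - D v x = integral {0..s} (\<lambda>r. DD (x + r *\<^sub>R u))" if s: "s \<ge> 0" for s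
  proof -
    have "((\<lambda>t. integral (cbox 0 s) (\<lambda>r. D u (x + t *\<^sub>R v + r *\<^sub>R u))) has_vector_derivative
        integral (cbox 0 s) (\<lambda>r. DD (x + 0 *\<^sub>R v + r *\<^sub>R u))) (at 0 within UNIV)"
    proof (rule leibniz_rule_vector_derivative[where U = UNIV])
      show "((\<lambda>t. D u (x + t *\<^sub>R v + r *\<^sub>R u)) has_vector_derivative DD (x + t *\<^sub>R v + r *\<^sub>R u)) (at t within UNIV)" for t r
        using dir[OF sD[of u], of "x + r *\<^sub>R u" v t UNIV] by (simp add: DD_def algebra_simps)
      show "(\<lambda>r. D u (x + t *\<^sub>R v + r *\<^sub>R u)) integrable_on cbox 0 s" for t
        by (intro integrable_continuous continuous_on_compose2[OF smooth_continuous_on[OF sD, of UNIV]] continuous_intros) auto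
      show "continuous_on (UNIV \<times> cbox 0 s) (\<lambda>(t, r). DD (x + t *\<^sub>R v + r *\<^sub>R u))"
        unfolding split_beta
        by (intro continuous_on_compose2[OF smooth_continuous_on[OF sDD, of UNIV]] continuous_intros) auto
    qed auto
    moreover have "integral (cbox 0 s) (\<lambda>r. D u (x + t *\<^sub>R v + r *\<^sub>R u)) = g (x + t *\<^sub>R v + s *\<^sub>R u) - g (x + t *\<^sub>R v)" for t
      unfolding cbox_interval
      using fundamental_theorem_of_calculus[OF s, of "\<lambda>r. g (x + t *\<^sub>R v + r *\<^sub>R u)"] dir[OF g, of "x + t *\<^sub>R v" u]
      by (intro integral_unique) (simp add: D_def)
    ultimately have 1: "((\<lambda>t. g (x + t *\<^sub>R v + s *\<^sub>R u) - g (x + t *\<^sub>R v)) has_vector_derivative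
        integral {0..s} (\<lambda>r. DD (x + r *\<^sub>R u))) (at 0)"
      by simp
    have 2: "((\<lambda>t. g (x + t *\<^sub>R v + s *\<^sub>R u) - g (x + t *\<^sub>R v)) has_vector_derivative
        (D v (x + s *\<^sub>R u) - D v x)) (at 0)"
      using has_vector_derivative_diff[OF dir[OF g, of "x + s *\<^sub>R u" v 0 UNIV] dir[OF g, of x v 0 UNIV]]
      by (simp add: D_def algebra_simps)
    show ?thesis using vector_derivative_unique_at[OF 1 2] by simp
  qed
  have c: "continuous_on {0..1} (\<lambda>r. DD (x + r *\<^sub>R u))"
    by (intro continuous_on_compose2[OF smooth_continuous_on[OF sDD, of UNIV]] continuous_intros) auto
  have "((\<lambda>s. integral {0..s} (\<lambda>r. DD (x + r *\<^sub>R u))) has_vector_derivative DD (x + 0 *\<^sub>R u)) (at 0 within {0..1})"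
    by (rule integral_has_vector_derivative[OF c]) auto
  then have 1: "((\<lambda>s. D v (x + s *\<^sub>R u) - D v x) has_vector_derivative DD (x + 0 *\<^sub>R u)) (at 0 within {0..1})"
    by (rule has_vector_derivative_transform[rotated 2]) (auto simp: eq)
  have 2: "((\<lambda>s. D v (x + s *\<^sub>R u) - D v x) has_vector_derivative frechet_derivative (D v) (at x) u) (at 0 within {0..1})"
    using dir[OF sD[of v], of x u 0 "{0..1}"] by (simp add: has_vector_derivative_diff_const)
  have "DD x = frechet_derivative (D v) (at x) u"
    using vector_derivative_unique_within[OF _ 1 2] by (simp add: trivial_limit_within islimpt_Icc)
  then show ?thesis unfolding DD_def D_def .
qed

lemma differentiable_upto_add:
  "differentiable_upto n f \<Longrightarrow> differentiable_upto n g \<Longrightarrow> differentiable_upto n (\<lambda>x. f x + g x)"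
proof (induction n arbitrary: f g)
  case (Suc n)
  have "frechet_derivative (\<lambda>x. f x + g x) (at x) v = frechet_derivative f (at x) v + frechet_derivative g (at x) v" for x v
    using Suc.prems by (subst frechet_eqI[OF has_derivative_add[OF has_derivative_frechet has_derivative_frechet]]) auto
  with Suc show ?case by simp
qed (simp add: continuous_on_add)

lemma smooth_add: "smooth f \<Longrightarrow> smooth g \<Longrightarrow> smooth (\<lambda>x. f x + g x)"
  by (simp add: smooth_def differentiable_upto_add)

lemma differentiable_upto_const: "differentiable_upto n (\<lambda>x. c)"
  by (induction n arbitrary: c) auto

lemma smooth_const: "smooth (\<lambda>x. c)"
  by (simp add: smooth_def differentiable_upto_const)

lemma smooth_sum: "(\<And>i. i \<in> A \<Longrightarrow> smooth (f i)) \<Longrightarrow> smooth (\<lambda>x. \<Sum>i\<in>A. f i x)"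
  by (induction A rule: infinite_finite_induct) (auto intro: smooth_add smooth_const)

lemma (in bounded_bilinear) smooth:
  assumes "smooth f" "smooth g"
  shows "smooth (\<lambda>x. prod (f x) (g x))"
proof -
  have "differentiable_upto n (\<lambda>x. prod (f x) (g x))" for n
    using assms
  proof (induction n arbitrary: f g)
    case 0
    then show ?case by (simp add: continuous_on smooth_continuous_on)
  next
    case (Suc n)
    note d = FDERIV[OF smooth_has_derivative[OF Suc.prems(1)] smooth_has_derivative[OF Suc.prems(2)]]
    have "differentiable_upto n (\<lambda>x. prod (f x) (frechet_derivative g (at x) v) + prod (frechet_derivative f (at x) v) (g x))" for v
      by (intro differentiable_upto_add Suc.IH smooth_directional Suc.prems)
    then show ?case using d by (auto simp: frechet_eqI[OF d] differentiable_def)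
  qed
  then show ?thesis by (simp add: smooth_def)
qed

lemma (in bounded_linear) smooth:
  assumes "smooth g"
  shows "smooth (\<lambda>x. f (g x))"
proof -
  have "differentiable_upto n (\<lambda>x. f (g x))" for n
    using assms
  proof (induction n arbitrary: g)
    case 0
    then show ?case by (simp add: continuous_on smooth_continuous_on)
  next
    case (Suc n)
    note d = has_derivative[OF smooth_has_derivative[OF Suc.prems]]
    have "differentiable_upto n (\<lambda>x. f (frechet_derivative g (at x) v))" for v
      by (intro Suc.IH smooth_directional Suc.prems)
    then show ?case using d by (auto simp: frechet_eqI[OF d] differentiable_def)
  qed
  then show ?thesis by (simp add: smooth_def)
qed

lemma smooth_ident: "smooth (\<lambda>x. x)"
proof -
  have "differentiable_upto n (\<lambda>x. x)" for n by (cases n) (auto simp: differentiable_upto_const)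
  then show ?thesis unfolding smooth_def by blast
qed


lemma iterated_deriv_append: "iterated_deriv g (us @ vs) = iterated_deriv (iterated_deriv g vs) us"
  by (induction us) auto

lemma smooth_iterated_deriv: "smooth g \<Longrightarrow> smooth (iterated_deriv g vs)"
  by (induction vs) (auto intro: smooth_directional)

lemma iterated_deriv_rotate:
  fixes g :: "'a::real_normed_vector \<Rightarrow> 'b::banach"
  assumes "smooth g"
  shows "iterated_deriv g (us @ v # vs) = iterated_deriv g (v # us @ vs)"
proof (induction us)
  case (Cons u us)
  have "iterated_deriv g ((u # us) @ v # vs) = iterated_deriv g (u # v # us @ vs)"
    using Cons by simp
  also have "\<dots> = iterated_deriv g (v # u # us @ vs)"
    using smooth_directional_symmetric[OF smooth_iterated_deriv[OF assms]] by simp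
  finally show ?case by simp
qed simp

lemma iterated_deriv_permute:
  fixes g :: "'a::real_normed_vector \<Rightarrow> 'b::banach"
  assumes "smooth g" "mset us = mset vs"
  shows "iterated_deriv g us = iterated_deriv g vs"
  using assms(2)
proof (induction us arbitrary: vs)
  case (Cons u us)
  then have "u \<in> set vs" by (metis list.set_intros(1) set_mset_mset)
  then obtain as bs where vs: "vs = as @ u # bs" by (meson split_list)
  with Cons.prems have "mset us = mset (as @ bs)" by simp
  from Cons.IH[OF this] show ?case
    unfolding vs iterated_deriv_rotate[OF assms(1)] by simp
qed simp

text \<open>
  After the expansion of \<open>v\<close>, symmetry moves each basis vector to the innermost position, where it
  is absorbed into the map. This permits inductions over the list of directions in which \<open>g\<close> varies.
\<close>

lemma iterated_deriv_basis:
  fixes g :: "'a::euclidean_space \<Rightarrow> 'b::banach"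
  assumes "smooth g"
  shows "iterated_deriv g (v # vs) y =
    (\<Sum>b\<in>Basis. (v \<bullet> b) *\<^sub>R iterated_deriv (\<lambda>y. frechet_derivative g (at y) b) vs y)"
proof -
  have lin: "linear (frechet_derivative (iterated_deriv g vs) (at y))"
    by (intro linear_frechet_derivative smooth_differentiable smooth_iterated_deriv assms)
  have "iterated_deriv g (v # vs) y = frechet_derivative (iterated_deriv g vs) (at y) (\<Sum>b\<in>Basis. (v \<bullet> b) *\<^sub>R b)"
    by (simp add: euclidean_representation)
  also have "\<dots> = (\<Sum>b\<in>Basis. (v \<bullet> b) *\<^sub>R iterated_deriv g (b # vs) y)"
    by (simp add: linear_sum[OF lin] linear_scale[OF lin])
  also have "\<dots> = (\<Sum>b\<in>Basis. (v \<bullet> b) *\<^sub>R iterated_deriv g (vs @ [b]) y)"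
    using iterated_deriv_permute[OF assms, of "b # vs" "vs @ [b]" for b] 
    by (intro sum.cong refl) simp
  finally show ?thesis by (simp add: iterated_deriv_append)
qed

text \<open>
  The product rule for \<open>g\<^bsup>(m)\<^esup>(y)[h\<^sub>1(y), \<dots>, h\<^sub>m(y)]\<close>. In \<open>iterated_deriv\<close> the directions are
  constants, so the dependence of each \<open>h\<^sub>i\<close> on \<open>y\<close> is first transferred to scalar factors by
  expanding it in the basis.
\<close>

lemma has_derivative_iterated_deriv:
  fixes g :: "'a::euclidean_space \<Rightarrow> 'b::banach"
  assumes "smooth g" "\<And>h. h \<in> set hs \<Longrightarrow> smooth h"
  shows "((\<lambda>y. iterated_deriv g (map (\<lambda>h. h y) hs) y) has_derivative
    (\<lambda>v. iterated_deriv g (v # map (\<lambda>h. h y) hs) y +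
      (\<Sum>i<length hs. iterated_deriv g ((map (\<lambda>h. h y) hs)[i := frechet_derivative (hs ! i) (at y) v]) y))) (at y)"
  using assms
proof (induction hs arbitrary: g)
  case Nil
  then show ?case by (simp add: smooth_has_derivative)
next
  case (Cons h hs)
  let ?m = "\<lambda>y. map (\<lambda>h. h y) hs"
  let ?G = "\<lambda>b y. frechet_derivative g (at y) b"
  have dh: "(h has_derivative frechet_derivative h (at y)) (at y)"
    using Cons.prems by (simp add: smooth_has_derivative)
  have "((\<lambda>y. iterated_deriv (?G b) (?m y) y) has_derivative
    (\<lambda>v. iterated_deriv (?G b) (v # ?m y) y +
      (\<Sum>i<length hs. iterated_deriv (?G b) ((?m y)[i := frechet_derivative (hs ! i) (at y) v]) y))) (at y)" for b
    using Cons.prems by (intro Cons.IH smooth_directional) auto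
  then have "((\<lambda>y. \<Sum>b\<in>Basis. (h y \<bullet> b) *\<^sub>R iterated_deriv (?G b) (?m y) y) has_derivative
    (\<lambda>v. \<Sum>b\<in>Basis. (h y \<bullet> b) *\<^sub>R (iterated_deriv (?G b) (v # ?m y) y +
      (\<Sum>i<length hs. iterated_deriv (?G b) ((?m y)[i := frechet_derivative (hs ! i) (at y) v]) y))
      + (frechet_derivative h (at y) v \<bullet> b) *\<^sub>R iterated_deriv (?G b) (?m y) y)) (at y)"
    by (intro has_derivative_sum has_derivative_scaleR has_derivative_inner_left dh)
  also have "(\<lambda>y. \<Sum>b\<in>Basis. (h y \<bullet> b) *\<^sub>R iterated_deriv (?G b) (?m y) y) =
      (\<lambda>y. iterated_deriv g (map (\<lambda>h. h y) (h # hs)) y)"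
    using iterated_deriv_basis[OF Cons.prems(1)] by simp
  also have "(\<lambda>v. \<Sum>b\<in>Basis. (h y \<bullet> b) *\<^sub>R (iterated_deriv (?G b) (v # ?m y) y +
      (\<Sum>i<length hs. iterated_deriv (?G b) ((?m y)[i := frechet_derivative (hs ! i) (at y) v]) y))
      + (frechet_derivative h (at y) v \<bullet> b) *\<^sub>R iterated_deriv (?G b) (?m y) y) =
     (\<lambda>v. iterated_deriv g (v # map (\<lambda>h. h y) (h # hs)) y +
      (\<Sum>i<length (h # hs). iterated_deriv g ((map (\<lambda>h. h y) (h # hs))[i := frechet_derivative ((h # hs) ! i) (at y) v]) y))"
    (is "?L = ?R")
  proof
    fix v
    have "?L v = iterated_deriv g (h y # v # ?m y) y +
       (\<Sum>i<length hs. iterated_deriv g (h y # (?m y)[i := frechet_derivative (hs ! i) (at y) v]) y) +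
       iterated_deriv g (frechet_derivative h (at y) v # ?m y) y"
      unfolding iterated_deriv_basis[OF Cons.prems(1)]
      by (subst sum.swap) (simp del: iterated_deriv.simps add: scaleR_add_right sum.distrib scaleR_sum_right)
    also have "iterated_deriv g (h y # v # ?m y) y = iterated_deriv g (v # h y # ?m y) y"
      using iterated_deriv_permute[OF Cons.prems(1), of "h y # v # ?m y" "v # h y # ?m y"] by simp
    finally show "?L v = ?R v"
      by (simp del: iterated_deriv.simps sum.lessThan_Suc add: sum.lessThan_Suc_shift)
  qed
  finally show ?case .
qed


section \<open>Smooth maps with complex-linear derivatives\<close>

text \<open>
  The class of maps in which the word basis functions live: complex linearity of the derivatives is
  what allows the complex coefficients of a word series to be taken out of iterated derivatives.
\<close>

definition csmooth :: "(complex ^ 'n::finite \<Rightarrow> complex ^ 'm::finite) \<Rightarrow> bool" where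
  "csmooth g \<longleftrightarrow> smooth g \<and>
     (\<forall>y c v. frechet_derivative g (at y) (c *s v) = c *s frechet_derivative g (at y) v)"

lemma csmooth_imp_smooth: "csmooth g \<Longrightarrow> smooth g"
  by (simp add: csmooth_def)

lemma csmooth_scale: "csmooth g \<Longrightarrow> frechet_derivative g (at y) (c *s v) = c *s frechet_derivative g (at y) v"
  by (simp add: csmooth_def)

lemma bounded_linear_vector_scale: "bounded_linear (\<lambda>v :: complex ^ 'n::finite. c *s v)"
proof -
  have "linear (\<lambda>v :: complex ^ 'n. c *s v)"
    by (auto simp: linear_iff vec_eq_iff algebra_simps)
  then show ?thesis by (simp add: linear_conv_bounded_linear)
qed

lemma has_derivative_vector_scale [derivative_intros]:
  "(g has_derivative g') F \<Longrightarrow> ((\<lambda>x. c *s g x) has_derivative (\<lambda>v. c *s g' v)) F"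
  for g :: "_ \<Rightarrow> complex ^ 'n::finite"
  by (rule bounded_linear.has_derivative[OF bounded_linear_vector_scale])

text \<open>
  By the symmetry of second derivatives, \<open>D\<^bsub>c u\<^esub> D\<^sub>v g = D\<^sub>v D\<^bsub>c u\<^esub> g = c D\<^sub>v D\<^sub>u g\<close>.
\<close>

lemma csmooth_directional:
  assumes "csmooth g"
  shows "csmooth (\<lambda>y. frechet_derivative g (at y) v)"
proof -
  note s = csmooth_imp_smooth[OF assms]
  have "frechet_derivative (\<lambda>y. frechet_derivative g (at y) v) (at y) (c *s u) =
     c *s frechet_derivative (\<lambda>y. frechet_derivative g (at y) v) (at y) u" for y c u
  proof -
    have "frechet_derivative (\<lambda>y. frechet_derivative g (at y) v) (at y) (c *s u) =
       frechet_derivative (\<lambda>y. c *s frechet_derivative g (at y) u) (at y) v"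
      by (simp add: smooth_directional_symmetric[OF s, of v] csmooth_scale[OF assms])
    also have "\<dots> = c *s frechet_derivative (\<lambda>y. frechet_derivative g (at y) u) (at y) v"
      by (intro fun_cong[OF frechet_eqI] has_derivative_vector_scale smooth_has_derivative smooth_directional s)
    finally show ?thesis by (simp add: smooth_directional_symmetric[OF s, of v])
  qed
  with s show ?thesis by (simp add: csmooth_def smooth_directional)
qed

lemma csmooth_iterated_deriv: "csmooth g \<Longrightarrow> csmooth (iterated_deriv g vs)"
  by (induction vs) (auto intro: csmooth_directional)

lemma csmooth_ident: "csmooth (\<lambda>y. y)"
  by (simp add: csmooth_def smooth_ident)

lemma smooth_lie_derivative:
  fixes g :: "'a::euclidean_space \<Rightarrow> 'b::banach"
  assumes "smooth g" "smooth h"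
  shows "smooth (\<lambda>y. frechet_derivative g (at y) (h y))"
proof -
  have "(\<lambda>y. frechet_derivative g (at y) (h y)) =
     (\<lambda>y. \<Sum>b\<in>Basis. (h y \<bullet> b) *\<^sub>R frechet_derivative g (at y) b)"
    by (rule ext) (rule iterated_deriv_basis[OF assms(1), where vs = "[]", unfolded iterated_deriv.simps])
  moreover have "smooth (\<lambda>y. (h y \<bullet> b) *\<^sub>R frechet_derivative g (at y) b)" for b
    by (rule bounded_bilinear.smooth[OF bounded_bilinear_scaleR
          bounded_linear.smooth[OF bounded_linear_inner_left assms(2)] smooth_directional[OF assms(1)]])
  ultimately show ?thesis by (simp add: smooth_sum)
qed

lemma csmooth_lie_derivative:
  assumes "csmooth g" "csmooth h"
  shows "csmooth (\<lambda>y. frechet_derivative g (at y) (h y))"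
proof -
  note s = csmooth_imp_smooth[OF assms(1)] csmooth_imp_smooth[OF assms(2)]
  have "frechet_derivative (\<lambda>y. frechet_derivative g (at y) (h y)) (at y) (c *s v) =
      c *s frechet_derivative (\<lambda>y. frechet_derivative g (at y) (h y)) (at y) v" for y c v
  proof -
    define d where "d = frechet_derivative (\<lambda>x. frechet_derivative g (at x) (h y)) (at y)"
    have "((\<lambda>y. frechet_derivative g (at y) (h y)) has_derivative
       (\<lambda>v. d v + frechet_derivative g (at y) (frechet_derivative h (at y) v))) (at y)"
      using has_derivative_iterated_deriv[OF s(1), of "[h]" y] s(2) by (simp add: d_def)
    note D = frechet_eqI[OF this]
    have "d (c *s v) = c *s d v"
      unfolding d_def by (rule csmooth_scale[OF csmooth_directional[OF assms(1)]])
    then show ?thesis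
      unfolding D by (simp only: csmooth_scale[OF assms(1)] csmooth_scale[OF assms(2)] vector_add_ldistrib)
  qed
  with smooth_lie_derivative[OF s] show ?thesis
    by (simp add: csmooth_def)
qed

text \<open>
  Insertion of sums over the fibres of \<open>m\<close> into the slots of a derivative; for \<open>m = mset\<close> these sums
  are the grades of a word series.
\<close>

lemma iterated_deriv_expand:
  fixes m :: "'w \<Rightarrow> 'k" and c :: "'w \<Rightarrow> complex ^ 'n::finite" and g :: "complex ^ 'n \<Rightarrow> complex ^ 'm::finite"
  assumes g: "csmooth g" and fin: "\<And>A. finite {w. m w = A}"
  shows "iterated_deriv g (map (\<lambda>A. \<Sum>w | m w = A. \<delta> w *s c w) As) =
    (\<lambda>y. \<Sum>ws | map m ws = As. prod_list (map \<delta> ws) *s iterated_deriv g (map c ws) y)"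
proof (induction As)
  case Nil
  show ?case by simp
next
  case (Cons A As)
  let ?V = "\<lambda>A. \<Sum>w | m w = A. \<delta> w *s c w"

  have set_eq: "{ws. map m ws = A # As} = (\<lambda>(w, ws). w # ws) ` ({w. m w = A} \<times> {ws. map m ws = As})"
    by (auto simp: map_eq_Cons_conv)
  have lin: "linear (frechet_derivative (iterated_deriv g vs) (at y))" for vs y
    by (intro linear_frechet_derivative smooth_differentiable smooth_iterated_deriv csmooth_imp_smooth g)
  show ?case
  proof
    fix y
    have "iterated_deriv g (map ?V (A # As)) y = frechet_derivative 
        (\<lambda>y. \<Sum>ws | map m ws = As. prod_list (map \<delta> ws) *s iterated_deriv g (map c ws) y) (at y) (?V A)"
      by (simp add: Cons.IH)
    also have "\<dots> = (\<Sum>ws | map m ws = As. prod_list (map \<delta> ws) *s 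
        frechet_derivative (iterated_deriv g (map c ws)) (at y) (?V A))"
      by (rule fun_cong[OF frechet_eqI[OF has_derivative_sum]], rule has_derivative_vector_scale, rule smooth_has_derivative,
         rule smooth_iterated_deriv, rule csmooth_imp_smooth, rule g)
    also have "\<dots> = (\<Sum>ws | map m ws = As. \<Sum>w | m w = A. 
        prod_list (map \<delta> (w # ws)) *s iterated_deriv g (map c (w # ws)) y)"
      by (intro sum.cong refl) 
        (simp add: linear_sum[OF lin] csmooth_scale[OF csmooth_iterated_deriv[OF g]] vec.scale_sum_right mult.commute)
    also have "\<dots> = (\<Sum>ws | map m ws = A # As. prod_list (map \<delta> ws) *s iterated_deriv g (map c ws) y)"
      unfolding set_eq
      by (subst sum.swap) (simp add: sum.cartesian_product sum.reindex inj_on_def split_def)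
    finally show "iterated_deriv g (map ?V (A # As)) y = 
       (\<Sum>ws | map m ws = A # As. prod_list (map \<delta> ws) *s iterated_deriv g (map c ws) y)" .
  qed
qed

text \<open>
  The differential operator \<open>D\<^sub>w\<close>, the composition of the derivations of the letters of \<open>w\<close>.
\<close>

primrec word_deriv :: "('l \<Rightarrow> complex ^ 'n::finite \<Rightarrow> complex ^ 'n) \<Rightarrow> 'l list \<Rightarrow> 
    (complex ^ 'n \<Rightarrow> complex ^ 'n) \<Rightarrow> complex ^ 'n \<Rightarrow> complex ^ 'n" where
  "word_deriv F [] g = g"
| "word_deriv F (l # w) g = (\<lambda>y. frechet_derivative (word_deriv F w g) (at y) (F l y))"

lemma word_deriv_append: "word_deriv F (v @ w) g = word_deriv F v (word_deriv F w g)"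
  by (induction v) auto

lemma word_basis_eq_word_deriv: "word_basis F w = word_deriv F w (\<lambda>y. y)"
  by (induction F w rule: word_basis.induct) auto

lemma csmooth_word_deriv: "(\<And>l. csmooth (F l)) \<Longrightarrow> csmooth g \<Longrightarrow> csmooth (word_deriv F w g)"
  by (induction w) (auto intro: csmooth_lie_derivative)

lemma csmooth_word_basis: "(\<And>l. csmooth (F l)) \<Longrightarrow> csmooth (word_basis F w)"
  by (simp add: word_basis_eq_word_deriv csmooth_word_deriv csmooth_ident)


section \<open>Fourier coefficients\<close>

lemma bounded_bilinear_vector_scale: "bounded_bilinear (\<lambda>c (v :: complex ^ 'n::finite). c *s v)"
proof -
  have "bilinear (\<lambda>c (v :: complex ^ 'n). c *s v)"
    by (auto simp: bilinear_def linear_iff vec_eq_iff algebra_simps)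
  then show ?thesis by (simp add: bilinear_conv_bounded_bilinear)
qed

lemma continuous_on_cis_kdot: "continuous_on S (\<lambda>x. cis (- kdot k (h x)))" if "continuous_on S h"
  unfolding kdot_def cis_conv_exp by (intro continuous_intros that)

lemma fourier_integrand_integrable:
  assumes "smooth (\<lambda>(y, \<theta>). f y \<theta>)"
  shows "(\<lambda>\<theta>. cis (- kdot k \<theta>) *s f y \<theta>) integrable_on cbox a b"
  using continuous_on_compose2[OF smooth_continuous_on[OF assms, of UNIV], of "cbox a b" "\<lambda>\<theta>. (y, \<theta>)"]
  by (intro integrable_continuous bounded_bilinear.continuous_on[OF bounded_bilinear_vector_scale]
       continuous_on_cis_kdot continuous_intros) (simp add: continuous_intros)

lemma has_derivative_first_argument:
  assumes "smooth (\<lambda>(y, \<theta>). f y \<theta>)"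
  shows "((\<lambda>y. f y \<theta>) has_derivative (\<lambda>v. frechet_derivative (\<lambda>(y, \<theta>). f y \<theta>) (at (y, \<theta>)) (v, 0))) (at y)"
proof -
  have "((\<lambda>y. (y, \<theta>)) has_derivative (\<lambda>v. (v, 0))) (at y)"
    by (auto intro!: derivative_eq_intros)
  from has_derivative_compose[OF this smooth_has_derivative[OF assms]] show ?thesis by simp
qed

lemma has_derivative_fourier_coeff:
  fixes f :: "complex ^ 'n::finite \<Rightarrow> real ^ 'd::finite \<Rightarrow> complex ^ 'n"
  assumes f: "smooth (\<lambda>(y, \<theta>). f y \<theta>)"
  shows "(fourier_coeff f k has_derivative
    (\<lambda>v. fourier_coeff (\<lambda>y \<theta>. frechet_derivative (\<lambda>(y, \<theta>). f y \<theta>) (at (y, \<theta>)) (v, 0)) k y)) (at y)"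
proof -
  let ?F = "\<lambda>(y, \<theta>). f y \<theta>"
  let ?D = "\<lambda>v y \<theta>. frechet_derivative ?F (at (y, \<theta>)) (v, 0)"
  define B where "B = (\<lambda>y \<theta>. Blinfun (\<lambda>v. cis (- kdot k \<theta>) *s ?D v y \<theta>))"
  note scaled = has_derivative_vector_scale[OF has_derivative_first_argument[OF f]]
  have B: "blinfun_apply (B y \<theta>) = (\<lambda>v. cis (- kdot k \<theta>) *s ?D v y \<theta>)" for y \<theta>
    unfolding B_def by (rule bounded_linear_Blinfun_apply[OF has_derivative_bounded_linear[OF scaled]])
  have cB: "continuous_on S (\<lambda>(y, \<theta>). B y \<theta>)" for S
  proof (rule continuous_on_blinfun_componentwise)
    fix v :: "complex ^ 'n"
    have "continuous_on S (\<lambda>p. cis (- kdot k (snd p)) *s frechet_derivative ?F (at p) (v, 0))"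
      by (intro bounded_bilinear.continuous_on[OF bounded_bilinear_vector_scale] continuous_on_cis_kdot
         continuous_intros smooth_continuous_on smooth_directional f)
    then show "continuous_on S (\<lambda>x. blinfun_apply (case x of (y, \<theta>) \<Rightarrow> B y \<theta>) v)"
      by (simp add: split_beta B)
  qed
  let ?b = "(\<chi> j. 2 * pi) :: real ^ 'd"
  have "((\<lambda>y. integral (cbox 0 ?b) (\<lambda>\<theta>. cis (- kdot k \<theta>) *s f y \<theta>)) has_derivative
      integral (cbox 0 ?b) (B y)) (at y within UNIV)"
    by (rule leibniz_rule[OF _ fourier_integrand_integrable[OF f] cB]) (auto simp: B intro: scaled)
  moreover have "blinfun_apply (integral (cbox 0 ?b) (B y)) v = integral (cbox 0 ?b) (\<lambda>\<theta>. blinfun_apply (B y \<theta>) v)" for v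
  proof -
    have "continuous_on (cbox 0 ?b) (B y)"
      using continuous_on_compose2[OF cB[of UNIV], of "cbox 0 ?b" "\<lambda>\<theta>. (y, \<theta>)"] by (simp add: continuous_intros)
    then have "B y integrable_on cbox 0 ?b" by (rule integrable_continuous)
    from integral_linear[OF this, of "\<lambda>h. blinfun_apply h v"] show ?thesis
      by (simp add: o_def bounded_linear_intros)
  qed
  ultimately show ?thesis
    unfolding fourier_coeff_def[abs_def] by (auto simp: B intro!: derivative_eq_intros)
qed

text \<open>
  The derivative of a Fourier coefficient in \<open>y\<close> is a Fourier coefficient of a partial derivative of
  \<open>f\<close>, which is jointly smooth again, so induction on the order of differentiability applies.
\<close>

lemma csmooth_fourier_coeff:
  fixes f :: "complex ^ 'n::finite \<Rightarrow> real ^ 'd::finite \<Rightarrow> complex ^ 'n"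
  assumes f: "smooth (\<lambda>(y, \<theta>). f y \<theta>)" and jac: "\<And>\<theta>. has_jacobian_matrices (\<lambda>y. f y \<theta>)"
  shows "csmooth (fourier_coeff f k)"
proof -
  have "differentiable_upto n (fourier_coeff f k)" for n
    using f
  proof (induction n arbitrary: f)
    case 0
    then show ?case
      using has_derivative_fourier_coeff[OF 0] 
      by (auto simp: continuous_on_eq_continuous_at intro: has_derivative_continuous)
  next
    case (Suc n)
    note d = has_derivative_fourier_coeff[OF Suc.prems]
    have "smooth (\<lambda>(y, \<theta>). frechet_derivative (\<lambda>(y, \<theta>). f y \<theta>) (at (y, \<theta>)) (v, 0))" for v
      using smooth_directional[OF Suc.prems, of "(v, 0)"] by (simp add: split_def)
    from Suc.IH[OF this] d show ?case
      by (auto simp: frechet_eqI[OF d] differentiable_def)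
  qed
  then have "smooth (fourier_coeff f k)" unfolding smooth_def by blast
  moreover have "frechet_derivative (fourier_coeff f k) (at y) (c *s v) =
      c *s frechet_derivative (fourier_coeff f k) (at y) v" for y c v
  proof -
    let ?D = "\<lambda>v y \<theta>. frechet_derivative (\<lambda>(y, \<theta>). f y \<theta>) (at (y, \<theta>)) (v, 0)"
    have D: "?D (c *s v) y \<theta> = c *s ?D v y \<theta>" for \<theta>
    proof -
      obtain A :: "complex ^ 'n ^ 'n" where A: "((\<lambda>y. f y \<theta>) has_derivative (\<lambda>v. A *v v)) (at y)"
        using jac[of \<theta>] by (auto simp: has_jacobian_matrices_def)
      from has_derivative_unique[OF has_derivative_first_argument[OF f] A] have "?D v y \<theta> = A *v v" for v by metis
      then show ?thesis by (simp add: vector_scalar_commute)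
    qed
    have s: "smooth (\<lambda>(y, \<theta>). ?D v y \<theta>)"
      using smooth_directional[OF f, of "(v, 0)"] by (simp add: split_def)
    have "fourier_coeff (?D (c *s v)) k y = c *s fourier_coeff (?D v) k y"
      using integral_linear[OF fourier_integrand_integrable[where k = k and y = y and a = 0 and b = "\<chi> j. 2 * pi", OF s] 
          bounded_linear_vector_scale[of c]]
      unfolding fourier_coeff_def D
      by (simp add: o_def vec_eq_iff mult.left_commute vector_scalar_mult_def)
    then show ?thesis by (simp add: frechet_eqI[OF has_derivative_fourier_coeff[OF f]])
  qed
  ultimately show ?thesis by (simp add: csmooth_def)
qed

lemma csmooth_scaleR:
  fixes g :: "complex ^ 'a::finite \<Rightarrow> complex ^ 'b::finite"
  assumes "csmooth g"
  shows "csmooth (\<lambda>y. r *\<^sub>R g y)"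
proof -
  have commute: "r *\<^sub>R (c *s u) = c *s (r *\<^sub>R u)" for c and u :: "complex ^ 'b"
    by (simp add: vec_eq_iff)
  have "frechet_derivative (\<lambda>y. r *\<^sub>R g y) (at y) = (\<lambda>v. r *\<^sub>R frechet_derivative g (at y) v)" for y
    by (intro frechet_eqI has_derivative_scaleR_right smooth_has_derivative csmooth_imp_smooth assms)
  moreover have "smooth (\<lambda>y. r *\<^sub>R g y)"
    by (rule bounded_linear.smooth[OF bounded_linear_scaleR_right]) (rule csmooth_imp_smooth[OF assms])
  ultimately show ?thesis
    unfolding csmooth_def by (simp add: csmooth_scale[OF assms] commute)
qed


section \<open>Substitution into and composition of word series\<close>

text \<open>
  The value does not depend on the chosen enumeration when \<open>g\<close> is smooth, as its derivatives are
  symmetric. Regarding it as a function of a multiset of words lets \<open>add_letter\<close> act on it.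
\<close>

definition taylor_coeff :: "('l \<Rightarrow> complex ^ 'n::finite \<Rightarrow> complex ^ 'n) \<Rightarrow> (complex ^ 'n \<Rightarrow> complex ^ 'n) \<Rightarrow>
    complex ^ 'n \<Rightarrow> 'l list multiset \<Rightarrow> complex ^ 'n" where
  "taylor_coeff F g y U = iterated_deriv g (map (\<lambda>w. word_basis F w y) (SOME ws. mset ws = U)) y"

lemma taylor_coeff_mset:
  assumes "smooth g"
  shows "taylor_coeff F g y (mset ws) = iterated_deriv g (map (\<lambda>w. word_basis F w y) ws) y"
proof -
  have "mset (SOME vs. mset vs = mset ws) = mset ws" by (rule someI) simp
  then have "mset (map (\<lambda>w. word_basis F w y) (SOME vs. mset vs = mset ws)) = mset (map (\<lambda>w. word_basis F w y) ws)"
    unfolding mset_map by simp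
  then show ?thesis
    unfolding taylor_coeff_def by (rule iterated_deriv_permute[OF assms, THEN fun_cong])
qed

lemma word_basis_Cons: "word_basis F (l # w) y = frechet_derivative (word_basis F w) (at y) (F l y)"
  by (simp add: word_basis_eq_word_deriv)

text \<open>
  Differentiating \<open>g\<^bsup>(m)\<^esup>(y)[f\<^bsub>w\<^sub>1\<^esub>(y), \<dots>, f\<^bsub>w\<^sub>m\<^esub>(y)]\<close> in the direction \<open>F\<^sub>l(y)\<close> either raises the order of
  the derivative of \<open>g\<close>, with the new direction \<open>f\<^sub>l\<close>, or replaces one \<open>f\<^bsub>w\<^sub>i\<^esub>\<close> by
  \<open>f'\<^bsub>w\<^sub>i\<^esub> F\<^sub>l = f\<^bsub>l w\<^sub>i\<^esub>\<close>. These are the two ways of adding a letter to a partition.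
\<close>

lemma has_derivative_taylor_coeff:
  assumes F: "\<And>l. csmooth (F l)" and g: "smooth g"
  obtains D where "((\<lambda>y. taylor_coeff F g y U) has_derivative D) (at y)"
    and "\<And>l. D (F l y) = add_letter l (taylor_coeff F g y) U"
proof -
  obtain ws where ws: "U = mset ws" by (metis ex_mset)
  let ?b = "\<lambda>y. map (\<lambda>w. word_basis F w y) ws"
  let ?D = "\<lambda>v. iterated_deriv g (v # ?b y) y +
    (\<Sum>i<length ws. iterated_deriv g ((?b y)[i := frechet_derivative (word_basis F (ws ! i)) (at y) v]) y)"
  have eq: "map (\<lambda>h. h y) (map (word_basis F) ws) = ?b y" for y by simp
  have base: "((\<lambda>y. iterated_deriv g (map (\<lambda>h. h y) (map (word_basis F) ws)) y) has_derivative
    (\<lambda>v. iterated_deriv g (v # map (\<lambda>h. h y) (map (word_basis F) ws)) y +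
      (\<Sum>i<length (map (word_basis F) ws). iterated_deriv g ((map (\<lambda>h. h y) (map (word_basis F) ws))
        [i := frechet_derivative (map (word_basis F) ws ! i) (at y) v]) y))) (at y)"
    by (rule has_derivative_iterated_deriv[OF g]) (auto intro: csmooth_imp_smooth csmooth_word_basis F)
  have summands: "(\<Sum>i<length (map (word_basis F) ws). iterated_deriv g ((map (\<lambda>h. h y) (map (word_basis F) ws))
        [i := frechet_derivative (map (word_basis F) ws ! i) (at y) v]) y) =
      (\<Sum>i<length ws. iterated_deriv g ((?b y)[i := frechet_derivative (word_basis F (ws ! i)) (at y) v]) y)" for v
    unfolding eq length_map by (intro sum.cong refl) (simp only: lessThan_iff nth_map)
  have 1: "((\<lambda>y. taylor_coeff F g y U) has_derivative ?D) (at y)"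
    unfolding ws taylor_coeff_mset[OF g] using base[unfolded summands] unfolding eq .
  have 2: "?D (F l y) = add_letter l (taylor_coeff F g y) U" for l
  proof -
    have "taylor_coeff F g y (add_mset [l] U) = iterated_deriv g (F l y # ?b y) y"
      using taylor_coeff_mset[OF g, of F y "[l] # ws"] by (simp add: ws)
    moreover have "(\<Sum>w\<in>#U. taylor_coeff F g y (add_mset (l # w) (U - {#w#}))) =
       (\<Sum>i<length ws. iterated_deriv g ((?b y)[i := frechet_derivative (word_basis F (ws ! i)) (at y) (F l y)]) y)"
      unfolding ws sum_mset_mset
    proof (intro sum.cong refl)
      fix i assume "i \<in> {..<length ws}"
      then have "add_mset (l # ws ! i) (mset ws - {#ws ! i#}) = mset (ws[i := l # ws ! i])"
        by (simp add: mset_update)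
      then show "taylor_coeff F g y (add_mset (l # ws ! i) (mset ws - {#ws ! i#})) =
         iterated_deriv g ((?b y)[i := frechet_derivative (word_basis F (ws ! i)) (at y) (F l y)]) y"
        by (simp only: taylor_coeff_mset[OF g] map_update word_basis_Cons)
    qed
    ultimately show ?thesis by (simp only: add_letter_def)
  qed
  show ?thesis by (rule that[OF 1 2])
qed

lemma has_derivative_add_letter:
  assumes "\<And>U. ((\<lambda>y. \<phi> y U) has_derivative D U) (at y)"
  shows "((\<lambda>y. add_letter l (\<phi> y) U) has_derivative (\<lambda>v. add_letter l (\<lambda>U. D U v) U)) (at y)"
proof -
  obtain ws where ws: "U = mset ws" by (metis ex_mset)
  show ?thesis unfolding add_letter_def ws sum_mset_mset
    by (intro has_derivative_add has_derivative_sum assms)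
qed

lemma has_derivative_block_sum:
  assumes "\<And>U. ((\<lambda>y. \<phi> y U) has_derivative D U) (at y)"
  shows "((\<lambda>y. block_sum x (\<phi> y)) has_derivative (\<lambda>v. block_sum x (\<lambda>U. D U v))) (at y)"
  using assms
proof (induction x arbitrary: \<phi> D)
  case (Cons l x)
  show ?case
    using Cons.IH[where \<phi> = "\<lambda>y. add_letter l (\<phi> y)" and D = "\<lambda>U v. add_letter l (\<lambda>U. D U v) U",
        OF has_derivative_add_letter[OF Cons.prems]]
    by (simp only: block_sum.simps)
qed simp

text \<open>
  The Faa di Bruno formula for \<open>D\<^sub>x g\<close>.
\<close>

theorem word_deriv_eq_block_sum:
  assumes F: "\<And>l. csmooth (F l)" and g: "smooth g"
  shows "word_deriv F x g y = block_sum x (taylor_coeff F g y)"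
proof (induction x arbitrary: y)
  case Nil
  show ?case using taylor_coeff_mset[OF g, of F y "[]"] by simp
next
  case (Cons l x)
  have "\<forall>U. \<exists>D. ((\<lambda>y. taylor_coeff F g y U) has_derivative D) (at y) \<and>
      D (F l y) = add_letter l (taylor_coeff F g y) U"
  proof
    fix U
    show "\<exists>D. ((\<lambda>y. taylor_coeff F g y U) has_derivative D) (at y) \<and>
        D (F l y) = add_letter l (taylor_coeff F g y) U"
      by (rule has_derivative_taylor_coeff[OF F g, where U = U and y = y]) (intro exI conjI)
  qed
  from choice[OF this] obtain D where D: "\<And>U. ((\<lambda>y. taylor_coeff F g y U) has_derivative D U) (at y)"
    "\<And>U. D U (F l y) = add_letter l (taylor_coeff F g y) U" by auto
  have "word_deriv F (l # x) g y = frechet_derivative (\<lambda>y. block_sum x (taylor_coeff F g y)) (at y) (F l y)"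
  proof -
    have "word_deriv F x g = (\<lambda>y. block_sum x (taylor_coeff F g y))" by (rule ext) (rule Cons)
    then show ?thesis by simp
  qed
  also have "\<dots> = block_sum x (\<lambda>U. D U (F l y))"
    by (rule fun_cong[OF frechet_eqI[OF has_derivative_block_sum[OF D(1)]]])
  finally show ?case by (simp add: D(2))
qed

lemma block_sum_component: "block_sum x \<Phi> $ j = block_sum x (\<lambda>U. \<Phi> U $ j)"
proof (induction x arbitrary: \<Phi>)
  case (Cons l x)
  have "add_letter l \<Phi> U $ j = add_letter l (\<lambda>U. \<Phi> U $ j) U" for U
  proof -
    obtain ws where ws: "U = mset ws" by (metis ex_mset)
    show ?thesis unfolding add_letter_def ws sum_mset_mset by simp
  qed
  then show ?case by (simp add: Cons.IH)
qed simp

lemma word_series_empty_grade: "word_series F \<delta> y {#} = \<delta> [] *s y"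
  by (simp add: word_series_def)

text \<open>
  Multilinear expansion of the Taylor series gives \<open>exp_sum \<delta> N\<close> of the Taylor coefficients, and by
  hypothesis this is a sum of block sums, which are the values \<open>D\<^sub>x g(y)\<close>. The hypothesis \<open>char\<close> is stated for
  scalar functions and is used componentwise.
\<close>

theorem formal_subst_word_series:
  fixes F :: "'l \<Rightarrow> complex ^ 'n::finite \<Rightarrow> complex ^ 'n"
  assumes F: "\<And>l. csmooth (F l)" and g: "csmooth g" and nil: "\<delta> [] = 1"
    and char: "\<And>N \<Phi>. exp_sum \<delta> N \<Phi> = (\<Sum>x | mset x = N. \<delta> x * block_sum x \<Phi>)"
  shows "formal_subst g (word_series F \<delta> y) N = (\<Sum>x | mset x = N. \<delta> x *s word_deriv F x g y)"
proof -
  note s = csmooth_imp_smooth[OF g]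
  let ?T = "{As. {#} \<notin> set As \<and> sum_list As = N}"
  let ?h = "\<lambda>ws. (1 / fact (length ws)) *\<^sub>R (prod_list (map \<delta> ws) *s taylor_coeff F g y (mset ws))"
  have "formal_subst g (word_series F \<delta> y) N =
     (\<Sum>As\<in>?T. (1 / fact (length As)) *\<^sub>R iterated_deriv g (map (\<lambda>A. \<Sum>w | mset w = A. \<delta> w *s word_basis F w y) As) y)"
    by (simp add: formal_subst_def word_series_empty_grade nil) (simp add: word_series_def[abs_def])
  also have "\<dots> = (\<Sum>As\<in>?T. \<Sum>ws | ws \<in> block_lists N \<and> map mset ws = As. ?h ws)"
  proof (intro sum.cong refl)
    fix As assume As: "As \<in> ?T"
    have ws: "{ws. ws \<in> block_lists N \<and> map mset ws = As} = {ws. map mset ws = As}"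
      using As by (auto simp: block_lists_def)
    have "iterated_deriv g (map (\<lambda>A. \<Sum>w | mset w = A. \<delta> w *s word_basis F w y) As) y =
       (\<Sum>ws | map mset ws = As. prod_list (map \<delta> ws) *s iterated_deriv g (map (\<lambda>w. word_basis F w y) ws) y)"
      by (rule fun_cong[OF iterated_deriv_expand[OF g finite_words_of_grade]])
    then show "(1 / fact (length As)) *\<^sub>R iterated_deriv g (map (\<lambda>A. \<Sum>w | mset w = A. \<delta> w *s word_basis F w y) As) y =
       (\<Sum>ws | ws \<in> block_lists N \<and> map mset ws = As. ?h ws)"
      unfolding ws by (simp add: scaleR_sum_right taylor_coeff_mset[OF s]) (auto intro!: sum.cong)
  qed
  also have "\<dots> = (\<Sum>ws\<in>block_lists N. ?h ws)"
    by (rule sum.group[OF finite_block_lists finite_grade_decompositions]) (auto simp: block_lists_def)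
  also have "\<dots> = (\<Sum>x | mset x = N. \<delta> x *s word_deriv F x g y)"
  proof (subst vec_eq_iff, rule allI)
    fix j
    have "(\<Sum>ws\<in>block_lists N. ?h ws) $ j = exp_sum \<delta> N (\<lambda>U. taylor_coeff F g y U $ j)"
      unfolding exp_sum_def sum_component 
      by (intro sum.cong refl) (simp only: vector_scaleR_component vector_smult_component, simp add: scaleR_conv_of_real)
    also have "\<dots> = (\<Sum>x | mset x = N. \<delta> x *s word_deriv F x g y) $ j"
      unfolding char word_deriv_eq_block_sum[OF F s] by (simp add: block_sum_component)
    finally show "(\<Sum>ws\<in>block_lists N. ?h ws) $ j = (\<Sum>x | mset x = N. \<delta> x *s word_deriv F x g y) $ j" .
  qed
  finally show ?thesis .
qed

lemma mset_drop_subset: "mset (drop i u) \<subseteq># mset u"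
  by (metis append_take_drop_id mset_append mset_subset_eq_add_right)

lemma mset_take_eq: "mset (take i u) = mset u - mset (drop i u)"
  by (metis add_diff_cancel_right' append_take_drop_id mset_append)

text \<open>
  By \<open>D\<^sub>v f\<^sub>w = f\<^bsub>v w\<^esub>\<close> the terms of the composition are indexed by pairs of words, equivalently by
  words with a cut.
\<close>

theorem word_series_subst_word_series:
  fixes F :: "'l \<Rightarrow> complex ^ 'n::finite \<Rightarrow> complex ^ 'n"
  assumes F: "\<And>l. csmooth (F l)" and nil: "\<delta> [] = 1"
    and char: "\<And>N \<Phi>. exp_sum \<delta> N \<Phi> = (\<Sum>x | mset x = N. \<delta> x * block_sum x \<Phi>)"
  shows "word_series_subst F \<eta> (word_series F \<delta> y) = word_series F (deconcat \<delta> \<eta>) y"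
proof
  fix M
  let ?f = "\<lambda>v w. (\<delta> v * \<eta> w) *s word_basis F (v @ w) y"
  have "word_series_subst F \<eta> (word_series F \<delta> y) M =
     (\<Sum>w | mset w \<subseteq># M. \<Sum>v | mset v = M - mset w. ?f v w)"
    unfolding word_series_subst_def
    by (intro sum.cong refl, subst formal_subst_word_series[OF F csmooth_word_basis[OF F] nil char])
       (simp add: word_basis_eq_word_deriv word_deriv_append vec.scale_sum_right mult.commute)
  also have "\<dots> = (\<Sum>(w, v)\<in>(SIGMA w:{w. mset w \<subseteq># M}. {v. mset v = M - mset w}). ?f v w)"
    by (rule sum.Sigma) (auto simp: finite_words_below finite_words_of_grade)
  also have "\<dots> = (\<Sum>(u, i)\<in>(SIGMA u:{u. mset u = M}. {..length u}). ?f (take i u) (drop i u))"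
    by (rule sum.reindex_bij_witness[where j = "\<lambda>(w, v). (v @ w, length v)" and i = "\<lambda>(u, i). (drop i u, take i u)"])
       (auto simp: mset_drop_subset mset_take_eq)
  also have "\<dots> = (\<Sum>u | mset u = M. \<Sum>i\<le>length u. ?f (take i u) (drop i u))"
    by (rule sum.Sigma[symmetric]) (auto simp: finite_words_of_grade)
  also have "\<dots> = word_series F (deconcat \<delta> \<eta>) y M"
    by (simp add: word_series_def deconcat_def vec.scale_sum_left)
  finally show "word_series_subst F \<eta> (word_series F \<delta> y) M = word_series F (deconcat \<delta> \<eta>) y M" .
qed


section \<open>The oscillatory and the averaged problem\<close>

lemma sum_words_snoc:
  assumes "N \<noteq> {#}"
  shows "(\<Sum>x | mset x = N. h x) = (\<Sum>k\<in>set_mset N. \<Sum>v | mset v = N - {#k#}. h (v @ [k]))"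
proof -
  have rev: "(\<Sum>x | mset x = M. q (rev x)) = (\<Sum>x | mset x = M. q x)" for M :: "'a multiset" and q :: "'a list \<Rightarrow> 'b"
    by (rule sum.reindex_bij_witness[where i = rev and j = rev]) auto
  have "(\<Sum>x | mset x = N. h x) = (\<Sum>k\<in>set_mset N. \<Sum>v | mset v = N - {#k#}. h (rev (k # v)))"
    unfolding rev[where M = N and q = h, symmetric] by (rule sum_words_Cons[OF assms])
  also have "\<dots> = (\<Sum>k\<in>set_mset N. \<Sum>v | mset v = N - {#k#}. h (v @ [k]))"
    using rev[where q = "\<lambda>v. h (v @ [k])" for k] by simp
  finally show ?thesis .
qed

lemma Gamma_coeff_Nil: "Gamma_coeff \<omega> \<tau> \<theta> \<theta>0 [] = 1"
  by (simp add: Gamma_coeff_def)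

lemma Gamma_coeff_initial: "Gamma_coeff \<omega> 0 \<theta> \<theta> w = (if w = [] then 1 else 0)"
  by (simp add: Gamma_coeff_def Gamma_coeff0_initial)

lemma word_series_Gamma_coeff_initial:
  "word_series F (Gamma_coeff \<omega> 0 \<theta> \<theta>) y = const_series y"
proof
  fix M
  have "word_series F (Gamma_coeff \<omega> 0 \<theta> \<theta>) y M = (\<Sum>w | mset w = M. if w = [] then y else 0)"
    unfolding word_series_def by (intro sum.cong refl) (simp add: Gamma_coeff_initial)
  also have "\<dots> = const_series y M"
    by (simp add: const_series_def finite_words_of_grade)
  finally show "word_series F (Gamma_coeff \<omega> 0 \<theta> \<theta>) y M = const_series y M" .
qed

lemma has_vector_derivative_word_series:
  fixes F :: "'l \<Rightarrow> complex ^ 'n::finite \<Rightarrow> complex ^ 'n"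
  assumes "\<And>w. ((\<lambda>t. \<delta> t w) has_vector_derivative \<delta>' w) (at t)"
  shows "((\<lambda>t. word_series F (\<delta> t) y M) has_vector_derivative word_series F \<delta>' y M) (at t)"
proof -
  have bl: "bounded_linear (\<lambda>c. c *s v)" for v :: "complex ^ 'n"
    by (rule bounded_bilinear.bounded_linear_left[OF bounded_bilinear_vector_scale])
  show ?thesis
    unfolding word_series_def
    by (intro has_vector_derivative_sum bounded_linear.has_vector_derivative[OF bl] assms)
qed

text \<open>
  Needed because \<open>beta_bar\<close> is a \<open>vector_derivative\<close>, which has a meaning only where the derivative
  exists. With both angles fixed the coefficients are polynomials in time.
\<close>

lemma Gamma_coeff0_time_differentiable: "\<exists>D. ((\<lambda>\<tau>. Gamma_coeff0 \<omega> \<tau> \<theta> \<theta>0 r w) has_vector_derivative D) (at \<tau>)"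
proof (induction r w rule: Gamma_coeff0_induct)
  case (Nil r)
  show ?case
  proof (cases r)
    case 0
    then show ?thesis by (auto intro: has_vector_derivative_const)
  next
    case (Suc q)
    then show ?thesis using has_vector_derivative_monomial[of q \<tau>] by (auto simp del: of_real_divide of_real_power)
  qed
next
  case (Zero r w)
  then show ?case by simp
next
  case (Single r k)
  obtain D where D: "((\<lambda>\<tau>. Gamma_coeff0 \<omega> \<tau> \<theta> \<theta>0 r []) has_vector_derivative D) (at \<tau>)"
    using Single(2) by blast
  obtain E where E: "((\<lambda>\<tau>. if r = 0 then cis (kdot k \<theta>0) else Gamma_coeff0 \<omega> \<tau> \<theta> \<theta>0 (r - 1) [k]) has_vector_derivative E) (at \<tau>)"
    using Single(3) has_vector_derivative_const by (cases "r = 0") fastforce+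
  show ?case unfolding Gamma_coeff0_single[OF Single(1), where r = r]
    by (rule exI, rule has_vector_derivative_mult_right, rule has_vector_derivative_diff[OF E],
       rule has_vector_derivative_mult_left[OF D])
next
  case (Merge r k l w)
  obtain D where D: "((\<lambda>\<tau>. Gamma_coeff0 \<omega> \<tau> \<theta> \<theta>0 r ((k + l) # w)) has_vector_derivative D) (at \<tau>)"
    using Merge(4) by blast
  obtain E where E: "((\<lambda>\<tau>. if r = 0 then cis (kdot k \<theta>0) * Gamma_coeff0 \<omega> \<tau> \<theta> \<theta>0 0 (l # w)
      else Gamma_coeff0 \<omega> \<tau> \<theta> \<theta>0 (r - 1) (k # l # w)) has_vector_derivative E) (at \<tau>)"
  proof (cases "r = 0")
    case True
    then obtain E where "((\<lambda>\<tau>. Gamma_coeff0 \<omega> \<tau> \<theta> \<theta>0 0 (l # w)) has_vector_derivative E) (at \<tau>)"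
      using Merge(2) by blast
    then have "((\<lambda>\<tau>. cis (kdot k \<theta>0) * Gamma_coeff0 \<omega> \<tau> \<theta> \<theta>0 0 (l # w)) has_vector_derivative cis (kdot k \<theta>0) * E) (at \<tau>)"
      by (rule has_vector_derivative_mult_right)
    then show ?thesis using True that by simp
  next
    case False
    then obtain E where "((\<lambda>\<tau>. Gamma_coeff0 \<omega> \<tau> \<theta> \<theta>0 (r - 1) (k # l # w)) has_vector_derivative E) (at \<tau>)"
      using Merge(3) by blast
    then show ?thesis using False that by (simp del: Gamma_coeff0.simps)
  qed
  show ?case unfolding Gamma_coeff0_merge[OF Merge(1), where r = r and l = l and w = w]
    by (rule exI, rule has_vector_derivative_mult_right, rule has_vector_derivative_diff[OF E D])
qed

text \<open>
  Differentiation of the one-parameter group law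
  \<open>\<alpha>\<^sub>b(t + s; t\<^sub>0) = \<alpha>\<^sub>b(t; t\<^sub>0) \<star> \<alpha>\<^sub>b(t\<^sub>0 + s; t\<^sub>0)\<close> at \<open>s = 0\<close>, where \<open>\<alpha>\<^sub>b\<close> denotes \<open>alpha_bar\<close>.
\<close>

lemma alpha_bar_derivative:
  "((\<lambda>t. alpha_bar \<omega> t0 t w) has_vector_derivative deconcat (alpha_bar \<omega> t0 t) (beta_bar \<omega> t0) w) (at t)"
proof -
  have beta: "((\<lambda>s. alpha_bar \<omega> t0 s v) has_vector_derivative beta_bar \<omega> t0 v) (at t0)" for v
  proof -
    obtain D where "((\<lambda>\<tau>. Gamma_coeff0 \<omega> \<tau> (t0 *\<^sub>R \<omega>) (t0 *\<^sub>R \<omega>) 0 v) has_vector_derivative D) (at (t0 - t0))"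
      using Gamma_coeff0_time_differentiable by blast
    moreover have "((\<lambda>s. s - t0) has_vector_derivative 1) (at t0)"
      by (auto intro!: derivative_eq_intros)
    ultimately have "((\<lambda>s. alpha_bar \<omega> t0 s v) has_vector_derivative D) (at t0)"
      using vector_diff_chain_at[of "\<lambda>s. s - t0" 1 t0] by (fastforce simp: o_def alpha_bar_def Gamma_coeff_def)
    then show ?thesis
      unfolding beta_bar_def by (simp add: vector_derivative_at)
  qed
  \<comment> \<open>The cocycle identity with all angles equal to \<open>t\<^sub>0 \<omega>\<close>.\<close>
  have group: "alpha_bar \<omega> t0 s w = deconcat (alpha_bar \<omega> t0 t) (alpha_bar \<omega> t0 (s - t + t0)) w" for s
    unfolding alpha_bar_def Gamma_coeff_cocycle by (simp add: algebra_simps)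
  have "((\<lambda>s. s - t + t0) has_vector_derivative 1) (at t)"
    by (auto intro!: derivative_eq_intros)
  then have shifted: "((\<lambda>s. alpha_bar \<omega> t0 (s - t + t0) v) has_vector_derivative beta_bar \<omega> t0 v) (at t)" for v
    using vector_diff_chain_at[of "\<lambda>s. s - t + t0" 1 t "\<lambda>s. alpha_bar \<omega> t0 s v" "beta_bar \<omega> t0 v"] beta[of v]
    by (simp add: o_def)
  have "((\<lambda>s. deconcat (alpha_bar \<omega> t0 t) (alpha_bar \<omega> t0 (s - t + t0)) w) has_vector_derivative
      deconcat (alpha_bar \<omega> t0 t) (beta_bar \<omega> t0) w) (at t)"
    unfolding deconcat_def by (intro has_vector_derivative_sum has_vector_derivative_mult_right shifted)
  then show ?thesis by (simp only: group[symmetric])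
qed

theorem theorem5:
  fixes \<omega> :: "real ^ 'd::finite" and t0 \<epsilon> :: real and y0 :: "complex ^ 'n::finite"
    and f :: "complex ^ 'n \<Rightarrow> real ^ 'd \<Rightarrow> complex ^ 'n"
  assumes "nonresonant \<omega>"
    and "smooth (\<lambda>(y, \<theta>). f y \<theta>)"
    and "\<And>y. torus_periodic (f y)"
    and "\<And>\<theta>. has_jacobian_matrices (\<lambda>y. f y \<theta>)"
  shows "let F = (\<lambda>k y. \<epsilon> *\<^sub>R fourier_coeff f k y);
             y = (\<lambda>t. word_series F (alpha \<omega> t0 t) y0);
             Y = (\<lambda>t. word_series F (alpha_bar \<omega> t0 t) y0)
         in solves_formal_ivp (\<lambda>t S. fourier_series_subst F S (t *\<^sub>R \<omega>)) t0 y0 y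
          \<and> (\<forall>t. y t = word_series_subst F (kappa \<omega> t0 (t *\<^sub>R \<omega>)) (Y t))
          \<and> solves_formal_ivp (\<lambda>t S. word_series_subst F (beta_bar \<omega> t0) S) t0 y0 Y"
proof -
  define F where "F = (\<lambda>k y. \<epsilon> *\<^sub>R fourier_coeff f k y)"
  let ?G = "\<lambda>t. Gamma_coeff \<omega> (t - t0) (t *\<^sub>R \<omega>) (t0 *\<^sub>R \<omega>)"
  define y where "y = (\<lambda>t. word_series F (alpha \<omega> t0 t) y0)"
  define Y where "Y = (\<lambda>t. word_series F (alpha_bar \<omega> t0 t) y0)"
  have F: "csmooth (F k)" for k
    unfolding F_def by (intro csmooth_scaleR csmooth_fourier_coeff assms)
  have alpha: "alpha \<omega> t0 t = ?G t" for t
    using alpha_eq_Gamma_coeff[OF assms(1)] by blast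
  note char = Gamma_coeff_character[OF assms(1)]
  have subst: "word_series_subst F \<eta> (word_series F (Gamma_coeff \<omega> \<tau> \<theta> \<theta>0) y0) =
      word_series F (deconcat (Gamma_coeff \<omega> \<tau> \<theta> \<theta>0) \<eta>) y0" for \<eta> \<tau> \<theta> \<theta>0
    by (rule word_series_subst_word_series[OF F Gamma_coeff_Nil char])
  have "solves_formal_ivp (\<lambda>t S. fourier_series_subst F S (t *\<^sub>R \<omega>)) t0 y0 y"
    unfolding solves_formal_ivp_def
  proof (intro conjI allI)
    show "y t0 = const_series y0"
      by (simp add: y_def alpha word_series_Gamma_coeff_initial)
    fix t M
    let ?\<delta>' = "\<lambda>w. if w = [] then 0 else ?G t (butlast w) * cis (kdot (last w) (t *\<^sub>R \<omega>))"
    have "((\<lambda>s. y s M) has_vector_derivative word_series F ?\<delta>' y0 M) (at t)"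
      unfolding y_def alpha by (intro has_vector_derivative_word_series Gamma_coeff_forward assms(1))
    also have "word_series F ?\<delta>' y0 M = fourier_series_subst F (y t) (t *\<^sub>R \<omega>) M"
    proof (cases "M = {#}")
      case True
      then show ?thesis by (simp add: word_series_def fourier_series_subst_def)
    next
      case False
      have "word_series F ?\<delta>' y0 M = (\<Sum>k\<in>set_mset M. \<Sum>v | mset v = M - {#k#}.
          (?G t v * cis (kdot k (t *\<^sub>R \<omega>))) *s word_basis F (v @ [k]) y0)"
        unfolding word_series_def sum_words_snoc[OF False] by simp
      also have "\<dots> = (\<Sum>k\<in>set_mset M. cis (kdot k (t *\<^sub>R \<omega>)) *s
          (\<Sum>v | mset v = M - {#k#}. ?G t v *s word_deriv F v (F k) y0))"
        by (intro sum.cong refl)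
          (simp add: word_basis_eq_word_deriv word_deriv_append vec.scale_sum_right mult.commute)
      also have "\<dots> = fourier_series_subst F (y t) (t *\<^sub>R \<omega>) M"
        unfolding fourier_series_subst_def y_def alpha formal_subst_word_series[OF F F Gamma_coeff_Nil char] ..
      finally show ?thesis .
    qed
    finally show "((\<lambda>s. y s M) has_vector_derivative fourier_series_subst F (y t) (t *\<^sub>R \<omega>) M) (at t)" .
  qed
  moreover have "y t = word_series_subst F (kappa \<omega> t0 (t *\<^sub>R \<omega>)) (Y t)" for t
  proof -
    have "deconcat (alpha_bar \<omega> t0 t) (kappa \<omega> t0 (t *\<^sub>R \<omega>)) = ?G t"
      unfolding alpha_bar_def kappa_def by (rule ext) (simp add: Gamma_coeff_cocycle)
    then show ?thesis
      unfolding Y_def y_def alpha alpha_bar_def subst by simp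
  qed
  moreover have "solves_formal_ivp (\<lambda>t S. word_series_subst F (beta_bar \<omega> t0) S) t0 y0 Y"
    unfolding solves_formal_ivp_def
  proof (intro conjI allI)
    show "Y t0 = const_series y0"
      by (simp add: Y_def alpha_bar_def word_series_Gamma_coeff_initial)
    fix t M
    have "((\<lambda>s. Y s M) has_vector_derivative word_series F (deconcat (alpha_bar \<omega> t0 t) (beta_bar \<omega> t0)) y0 M) (at t)"
      unfolding Y_def by (intro has_vector_derivative_word_series alpha_bar_derivative)
    then show "((\<lambda>s. Y s M) has_vector_derivative word_series_subst F (beta_bar \<omega> t0) (Y t) M) (at t)"
      unfolding Y_def alpha_bar_def subst .
  qed
  ultimately show ?thesis
    unfolding Let_def F_def[symmetric] y_def Y_def by blast
qed

end
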